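(* Let $d>0$. For every $K\in\,]K_m,+\infty[$, the restriction of the map $F$ to $\mathcal C_K^+$ is conjugated to the rotation on the circle $\mathbb T$ with angle $2\pi\theta_d(K)\in\,]0,\pi[$, where $\theta_d(K)$ is given by $$2\theta_d(K)=\frac{\displaystyle\int_0^{\sqrt{(e_1-e_3)/\nu}}\frac{du}{\sqrt{(1+u^2)(1+\varepsilon u^2)}}}{\displaystyle\int_0^{+\infty}\frac{du}{\sqrt{(1+u^2)(1+\varepsilon u^2)}}}$$ (with $e_1,e_3,\nu,\varepsilon$ the functions of $K$ defined in the context). Moreover the map $K\mapsto\theta_d(K)$ is analytic on $]K_m,+\infty[$.
   Context: Fix $d>0$. The map $F:(0,\infty)^2\to(0,\infty)^2$ is $F(x,y)=\Big(\frac{y+d}{xy},\ \frac{dxy+y+d}{y(y+d)}\Big)$; it is a homeomorphism of $(0,\infty)^2$. It leaves invariant the function $G(x,y)=x+y+\frac1x+\frac1y+\frac{d}{xy}$ on $(0,\infty)^2$. Let $\ell>0$ be the unique positive solution of $t^3-t-d=0$ and $K_m=\frac{4\ell+3d}{\ell^2}=3\ell+\frac1\ell$, which is the minimum of $G$. For $K>K_m$, $\mathcal C_K^+=\{(x,y)\in(0,\infty)^2: G(x,y)=K\}$; it is the positive part of the cubic curve $xy(x+y)+(x+y)+d-Kxy=0$ and is invariant under $F$. For $K>K_m$ put $A=K^3-8K-12d$, and let $e_3<e_2<e_1$ be the three real roots (in $X$) of $$4\big(X-\tfrac{A}{12}\big)^3+A\big(X-\tfrac{A}{12}\big)^2+4(K+3d)(K+d)\big(X-\tfrac{A}{12}\big)-4d(K+d)^2,$$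 which is a polynomial of the form $4X^3-g_2X-g_3$. Put $X(K)=\frac{K^3}{12}-\frac{2K}{3}$, $\nu=X(K)-e_1>0$ and $\varepsilon=\frac{e_1-e_2}{e_1-e_3}>0$. $\mathbb T$ denotes the circle; "conjugated" means conjugated by a homeomorphism from $\mathcal C_K^+$ onto $\mathbb T$. *)

theory Defs
  imports "HOL-Analysis.Analysis"
begin

definition conjugated_on ::
  "'a::topological_space set \<Rightarrow> ('a \<Rightarrow> 'a) \<Rightarrow> 'b::topological_space set \<Rightarrow> ('b \<Rightarrow> 'b) \<Rightarrow> bool" where
  "conjugated_on S f T g \<longleftrightarrow>
     f ` S \<subseteq> S \<and> g ` T \<subseteq> T \<and>
     (\<exists>h h'. homeomorphism S T h h' \<and> (\<forall>x\<in>S. h (f x) = g (h x)))"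

definition circle :: "complex set" where
  "circle = sphere 0 1"

definition rotation :: "real \<Rightarrow> complex \<Rightarrow> complex" where
  "rotation \<alpha> z = cis \<alpha> * z"

text \<open>Analyticity of a function of a real variable on an open set: the function is locally the sum
  of a power series. The library's \<open>analytic_on\<close> only concerns complex functions.\<close>

definition real_analytic_on :: "(real \<Rightarrow> real) \<Rightarrow> real set \<Rightarrow> bool" where
  "real_analytic_on f S \<longleftrightarrow>
     (\<forall>x\<in>S. \<exists>r>0. \<exists>a :: nat \<Rightarrow> real. \<forall>y\<in>ball x r. (\<lambda>n. a n * (y - x) ^ n) sums f y)"

definition F :: "real \<Rightarrow> real \<times> real \<Rightarrow> real \<times> real" where
  "F d = (\<lambda>(x, y). ((y + d) / (x * y), (d * x * y + y + d) / (y * (y + d))))"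

definition G :: "real \<Rightarrow> real \<times> real \<Rightarrow> real" where
  "G d = (\<lambda>(x, y). x + y + 1 / x + 1 / y + d / (x * y))"

definition ell :: "real \<Rightarrow> real" where
  "ell d = (THE t. t > 0 \<and> t ^ 3 - t - d = 0)"

definition K_min :: "real \<Rightarrow> real" where
  "K_min d = (4 * ell d + 3 * d) / (ell d)\<^sup>2"

definition C_plus :: "real \<Rightarrow> real \<Rightarrow> (real \<times> real) set" where
  "C_plus d K = {p \<in> {0<..} \<times> {0<..}. G d p = K}"

definition A :: "real \<Rightarrow> real \<Rightarrow> real" where
  "A d K = K ^ 3 - 8 * K - 12 * d"

definition cubic :: "real \<Rightarrow> real \<Rightarrow> real \<Rightarrow> real" where
  "cubic d K X =
     4 * (X - A d K / 12) ^ 3 + A d K * (X - A d K / 12)\<^sup>2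
     + 4 * (K + 3 * d) * (K + d) * (X - A d K / 12) - 4 * d * (K + d)\<^sup>2"

text \<open>The increasing list of the real roots of the cubic; lemma \<open>e_roots\<close> below shows that there
  are exactly three of them in the parameter range of interest.\<close>

definition roots :: "real \<Rightarrow> real \<Rightarrow> real list" where
  "roots d K = sorted_list_of_set {X. cubic d K X = 0}"

definition e3 :: "real \<Rightarrow> real \<Rightarrow> real" where "e3 d K = roots d K ! 0"
definition e2 :: "real \<Rightarrow> real \<Rightarrow> real" where "e2 d K = roots d K ! 1"
definition e1 :: "real \<Rightarrow> real \<Rightarrow> real" where "e1 d K = roots d K ! 2"

definition X_coord :: "real \<Rightarrow> real" where
  "X_coord K = K ^ 3 / 12 - 2 * K / 3"

definition nu :: "real \<Rightarrow> real \<Rightarrow> real" where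
  "nu d K = X_coord K - e1 d K"

definition eps :: "real \<Rightarrow> real \<Rightarrow> real" where
  "eps d K = (e1 d K - e2 d K) / (e1 d K - e3 d K)"

definition integrand :: "real \<Rightarrow> real \<Rightarrow> real" where
  "integrand \<epsilon> u = 1 / sqrt ((1 + u\<^sup>2) * (1 + \<epsilon> * u\<^sup>2))"

text \<open>Henstock-Kurzweil integrals; the integrand is positive and continuous for \<open>\<epsilon> > 0\<close>, so over
  \<open>{0..}\<close> this is the improper (equivalently, Lebesgue) integral.\<close>

definition theta :: "real \<Rightarrow> real \<Rightarrow> real" where
  "theta d K =
     (integral {0..sqrt ((e1 d K - e3 d K) / nu d K)} (integrand (eps d K))
      / integral {0..} (integrand (eps d K))) / 2"

lemma ell_ex1:
  assumes "d > (0::real)"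
  shows "\<exists>!t. t > 0 \<and> t ^ 3 - t - d = 0"
proof -
  have "\<exists>t\<ge>1. t \<le> 1 + d \<and> t ^ 3 - t - d = 0"
  proof (rule IVT')
    have "(1 + d) ^ 3 - (1 + d) - d = d + 3 * d\<^sup>2 + d ^ 3"
      by (simp add: power2_eq_square power3_eq_cube algebra_simps)
    with assms show "0 \<le> (1 + d) ^ 3 - (1 + d) - d" by simp
  qed (use assms in \<open>auto intro!: continuous_intros\<close>)
  then obtain t where t: "t \<ge> 1" "t ^ 3 - t - d = 0" by auto
  show ?thesis
  proof (rule ex1I[of _ t])
    fix s assume s: "s > 0 \<and> s ^ 3 - s - d = 0"
    have "s * (s\<^sup>2 - 1) > 0" using s assms by (simp add: power2_eq_square power3_eq_cube algebra_simps)
    then have "s\<^sup>2 > 1" using s by (simp add: zero_less_mult_iff)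
    have "t\<^sup>2 \<ge> 1" using t by simp
    have "(s - t) * (s\<^sup>2 + s * t + t\<^sup>2 - 1) = (s ^ 3 - s - d) - (t ^ 3 - t - d)"
      by (simp add: power2_eq_square power3_eq_cube algebra_simps)
    then have "(s - t) * (s\<^sup>2 + s * t + t\<^sup>2 - 1) = 0" using s t by simp
    moreover have "s\<^sup>2 + s * t + t\<^sup>2 - 1 > 0"
    proof -
      have "s * t > 0" using s t by simp
      then show ?thesis using \<open>s\<^sup>2 > 1\<close> \<open>t\<^sup>2 \<ge> 1\<close> by linarith
    qed
    ultimately show "s = t" by simp
  qed (use t in auto)
qed

lemma ell_props:
  assumes "d > 0"
  shows "ell d > 1" "d = ell d ^ 3 - ell d" "K_min d = 3 * ell d + 1 / ell d"
proof -
  let ?l = "ell d"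
  have l: "?l > 0 \<and> ?l ^ 3 - ?l - d = 0"
    unfolding ell_def by (rule theI'[OF ell_ex1[OF assms]])
  then show d: "d = ?l ^ 3 - ?l" by simp
  have "?l * (?l\<^sup>2 - 1) > 0" using l assms by (simp add: power2_eq_square power3_eq_cube algebra_simps)
  then have "?l\<^sup>2 > 1" using l by (simp add: zero_less_mult_iff)
  then show "?l > 1" using l power_le_one[of ?l 2] by linarith
  have "4 * ?l + 3 * d = (3 * ?l + 1 / ?l) * ?l\<^sup>2"
    using d l by (simp add: power2_eq_square power3_eq_cube distrib_right)
  then show "K_min d = 3 * ?l + 1 / ?l" unfolding K_min_def using l by simp
qed

text \<open>At \<open>K = K_min d\<close> the shifted cubic has the double root \<open>- 2 l (l\<^sup>2 + 1)\<close>; for larger \<open>K\<close>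
  it is positive there, which separates its two negative roots.\<close>

lemma cubic_double_root_at_K_min:
  fixes l m M d y0 :: real
  assumes lm: "l * m = 1" and M: "M = 3 * l + m" and d: "d = l ^ 3 - l" and y0: "y0 = - 2 * l * (l\<^sup>2 + 1)"
  and aM: "M ^ 3 - 8 * M - 12 * d = 15 * l ^ 3 + 15 * l + m + m ^ 3"
  shows "4 * y0 ^ 3 + (M ^ 3 - 8 * M - 12 * d) * y0\<^sup>2
        + 4 * (M + 3 * d) * (M + d) * y0 - 4 * d * (M + d)\<^sup>2 = 0"
proof -
  define b where "b = l\<^sup>2 + 1"
  have y: "y0 = - 2 * l * b" by (simp add: y0 b_def)
  have 1: "M + d = b\<^sup>2 * m" unfolding M d b_def using lm by algebra
  have 2: "(M + 3 * d) * l = 3 * l ^ 4 + 1" unfolding M d using lm by algebra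
  have 3: "- 32 * l ^ 3 * b + (15 * l ^ 3 + 15 * l + m + m ^ 3) * 4 * l\<^sup>2 - 8 * b * m * (3 * l ^ 4 + 1)
     - 4 * d * b\<^sup>2 * m\<^sup>2 = 0" unfolding d b_def using lm by algebra
  have "4 * y0 ^ 3 + (M ^ 3 - 8 * M - 12 * d) * y0\<^sup>2
        + 4 * (M + 3 * d) * (M + d) * y0 - 4 * d * (M + d)\<^sup>2
     = 4 * y0 ^ 3 + (15 * l ^ 3 + 15 * l + m + m ^ 3) * y0\<^sup>2
        - 8 * ((M + 3 * d) * l) * (b\<^sup>2 * m) * b - 4 * d * (b\<^sup>2 * m)\<^sup>2"
    unfolding aM 1 by (simp add: y)
  also have "\<dots> = b\<^sup>2 * (- 32 * l ^ 3 * b + (15 * l ^ 3 + 15 * l + m + m ^ 3) * 4 * l\<^sup>2 - 8 * b * m * (3 * l ^ 4 + 1)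
     - 4 * d * b\<^sup>2 * m\<^sup>2)" unfolding 2 y by algebra
  finally show ?thesis unfolding 3 by simp
qed

lemma e_roots:
  assumes d: "d > 0" and K: "K > K_min d"
  shows "e3 d K < e2 d K" "e2 d K < e1 d K"
    and "{X. cubic d K X = 0} = {e1 d K, e2 d K, e3 d K}"
    and "nu d K > 0"
proof -
  define l where "l = ell d"
  define s where "s = K - K_min d"
  define M where "M = K_min d"
  have Keq: "K = M + s" by (simp add: s_def M_def)
  have s: "s > 0" using K by (simp add: s_def)
  have l: "l > 1" and dl: "d = l ^ 3 - l" and M: "M = 3 * l + 1 / l"
    using ell_props[OF d] by (auto simp: l_def M_def)
  define m where "m = 1 / l"
  have m: "m > 0" "m < 1" "l * m = 1" using l by (auto simp: m_def)
  have Mm: "M = 3 * l + m" by (simp add: M m_def)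
  have M3: "M > 3" using Mm l m by linarith
  have M2: "M\<^sup>2 > 9" using power_strict_mono[of 3 M 2] M3 by simp
  define a where "a = A d K"
  define q where "q = (\<lambda>y. 4 * y ^ 3 + a * y\<^sup>2 + 4 * (K + 3 * d) * (K + d) * y - 4 * d * (K + d)\<^sup>2)"
  have cubic: "cubic d K X = q (X - a / 12)" for X by (simp add: cubic_def q_def a_def)
  define y0 where "y0 = - 2 * l * (l\<^sup>2 + 1)"

  have aM: "M ^ 3 - 8 * M - 12 * d = 15 * l ^ 3 + 15 * l + m + m ^ 3"
    using m(3) Mm dl by algebra
  have "a = (M ^ 3 - 8 * M - 12 * d) + s * (3 * M\<^sup>2 - 8 + 3 * M * s + s\<^sup>2)"
    by (simp add: a_def A_def Keq power2_eq_square power3_eq_cube algebra_simps)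
  moreover have "s * (3 * M\<^sup>2 - 8 + 3 * M * s + s\<^sup>2) > 0"
  proof -
    have "3 * M * s > 0" using M3 s by simp
    then have "3 * M\<^sup>2 - 8 + 3 * M * s + s\<^sup>2 > 0" using M2 s zero_le_power2[of s] by linarith
    with s show ?thesis by simp
  qed
  moreover have "m ^ 3 > 0" using m by simp
  ultimately have a: "a > 15 * l ^ 3 + 15 * l" using aM m by linarith
  have l3: "l ^ 3 > 0" using l by simp
  have y0: "y0 < 0" "- a < y0"
  proof -
    have e: "y0 = - (2 * l ^ 3 + 2 * l)" by (simp add: y0_def power2_eq_square power3_eq_cube algebra_simps)
    show "y0 < 0" "- a < y0" using e a l l3 by linarith+
  qed
  have K0: "K > 0" using M3 s Keq by simp
  have q1: "q (- a) < 0"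
  proof -
    have "a > 0" using a l l3 by linarith
    have "q (- a) = - 3 * a ^ 3 - 4 * (K + 3 * d) * (K + d) * a - 4 * d * (K + d)\<^sup>2"
      unfolding q_def by algebra
    moreover have "a ^ 3 > 0" "4 * (K + 3 * d) * (K + d) * a > 0" "4 * d * (K + d)\<^sup>2 > 0"
      using \<open>a > 0\<close> K0 d by auto
    ultimately show ?thesis by linarith
  qed
  have q3: "q 0 < 0" using d K0 by (simp add: q_def)
  have q4: "q d > 0"
  proof -
    have "q d = 4 * d ^ 3 + a * d\<^sup>2 + 8 * d\<^sup>2 * (K + d)"
      unfolding q_def by algebra
    moreover have "a > 0" using a l l3 by linarith
    ultimately show ?thesis using d K0 by (simp add: add_pos_pos)
  qed
  define w where "w = 2 * l ^ 3 + 2 * l"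
  have y0w: "y0 = - w" by (simp add: y0_def w_def power2_eq_square power3_eq_cube algebra_simps)
  have l3l: "l ^ 3 > l" using power_strict_increasing[of 1 3 l] l by simp
  have w: "w > 4" "2 * d < w" using l3l l unfolding w_def dl by auto
  have Mw: "M < w" using l3l l m unfolding w_def Mm by linarith
  have M4: "M > 4"
  proof -
    have "0 \<le> m * (l - 1)\<^sup>2" using m by simp
    also have "\<dots> = (l * m) * l - 2 * (l * m) + m" by (simp add: power2_eq_square algebra_simps)
    finally have "l + m \<ge> 2" using m by simp
    then show ?thesis unfolding Mm using l by linarith
  qed
  have q2: "q y0 > 0"
  proof -
    note base = cubic_double_root_at_K_min[OF m(3) Mm dl y0_def aM]
    have "q y0 = (4 * y0 ^ 3 + (M ^ 3 - 8 * M - 12 * d) * y0\<^sup>2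
        + 4 * (M + 3 * d) * (M + d) * y0 - 4 * d * (M + d)\<^sup>2)
        + s * (y0\<^sup>2 * (3 * M\<^sup>2 - 8) + 4 * y0 * (2 * M + 4 * d) - 8 * d * (M + d))
        + s\<^sup>2 * (3 * M * y0\<^sup>2 + 4 * y0 - 4 * d) + s ^ 3 * y0\<^sup>2"
      unfolding q_def a_def A_def Keq by algebra
    moreover have "y0\<^sup>2 * (3 * M\<^sup>2 - 8) + 4 * y0 * (2 * M + 4 * d) - 8 * d * (M + d) > 0"
    proof -
      have "M\<^sup>2 > 16" using power_strict_mono[of 4 M 2] M4 by simp
      then have "w\<^sup>2 * (3 * M\<^sup>2 - 8) > w\<^sup>2 * 40" using w by (intro mult_strict_left_mono) auto
      moreover have "w\<^sup>2 > 0" using w by simp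
      moreover have "w * M \<le> w\<^sup>2" using w Mw by (simp add: power2_eq_square)
      moreover have "2 * (w * d) \<le> w\<^sup>2" using w by (simp add: power2_eq_square)
      moreover have "2 * (d * M) \<le> w\<^sup>2"
        using mult_mono[of "2 * d" w M w] w Mw M4 by (simp add: power2_eq_square)
      moreover have "2 * (d * d) \<le> w\<^sup>2"
        using mult_mono[of "2 * d" w d w] w d by (simp add: power2_eq_square)
      moreover have "y0\<^sup>2 * (3 * M\<^sup>2 - 8) + 4 * y0 * (2 * M + 4 * d) - 8 * d * (M + d) =
        w\<^sup>2 * (3 * M\<^sup>2 - 8) - 8 * (w * M) - 16 * (w * d) - 8 * (d * M) - 8 * (d * d)"
        by (simp add: y0w algebra_simps)
      ultimately show ?thesis by linarith
    qed
    moreover have "3 * M * y0\<^sup>2 + 4 * y0 - 4 * d > 0"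
    proof -
      have "M * (w * w) \<ge> 4 * (4 * w)" using M4 w by (intro mult_mono) auto
      moreover have "3 * M * y0\<^sup>2 + 4 * y0 - 4 * d = 3 * (M * (w * w)) - 4 * w - 4 * d"
        by (simp add: y0w power2_eq_square)
      ultimately show ?thesis using w by linarith
    qed
    moreover have "s ^ 3 * y0\<^sup>2 > 0" using s y0 by simp
    ultimately show ?thesis using base s by (simp add: add_pos_pos)
  qed

  have cont: "continuous_on S q" for S unfolding q_def by (intro continuous_intros)
  obtain r3 where r3: "- a \<le> r3" "r3 \<le> y0" "q r3 = 0"
    using IVT'[of q "- a" 0 y0] q1 q2 y0 cont by force
  obtain r2 where r2: "y0 \<le> r2" "r2 \<le> 0" "q r2 = 0"
    using IVT2'[of q 0 0 y0] q2 q3 y0 cont by force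
  obtain r1 where r1: "0 \<le> r1" "r1 \<le> d" "q r1 = 0"
    using IVT'[of q 0 0 d] q3 q4 d cont by force
  have "r3 \<noteq> y0" "r2 \<noteq> y0" "r2 \<noteq> 0" "r1 \<noteq> 0" "r1 \<noteq> d" using r1 r2 r3 q2 q3 q4 by auto
  then have lt: "r3 < r2" "r2 < r1" "r1 < d" using r1 r2 r3 by auto
  have q_roots: "q y = 0 \<longleftrightarrow> y \<in> {r1, r2, r3}" for y
  proof
    assume y: "q y = 0"
    define p where "p = 4 * (K + 3 * d) * (K + d)"
    define c where "c = 4 * d * (K + d)\<^sup>2"
    have qq: "q x = 4 * x ^ 3 + a * x\<^sup>2 + p * x - c" for x by (simp add: q_def p_def c_def)
    have D: "q u - q v = (u - v) * (4 * (u\<^sup>2 + u * v + v\<^sup>2) + a * (u + v) + p)" for u v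
      unfolding qq by algebra
    show "y \<in> {r1, r2, r3}"
    proof (rule ccontr)
      assume n: "y \<notin> {r1, r2, r3}"
      have 1: "4 * (y\<^sup>2 + y * r1 + r1\<^sup>2) + a * (y + r1) + p = 0" using D[of y r1] y r1 n by auto
      have 2: "4 * (r2\<^sup>2 + r2 * r1 + r1\<^sup>2) + a * (r2 + r1) + p = 0" using D[of r2 r1] r2 r1 lt by auto
      have 3: "4 * (r3\<^sup>2 + r3 * r1 + r1\<^sup>2) + a * (r3 + r1) + p = 0" using D[of r3 r1] r3 r1 lt by auto
      have "(y - r2) * (4 * (y + r2 + r1) + a) = 0" using 1 2 by algebra
      then have 4: "4 * (y + r2 + r1) + a = 0" using n by simp
      have "(r3 - r2) * (4 * (r3 + r2 + r1) + a) = 0" using 3 2 by algebra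
      then have "4 * (r3 + r2 + r1) + a = 0" using lt by simp
      with 4 n show False by simp
    qed
  qed (use r1 r2 r3 in auto)
  have set_eq: "{X. cubic d K X = 0} = {r3 + a / 12, r2 + a / 12, r1 + a / 12}"
    by (auto simp: cubic q_roots)
  have "roots d K = [r3 + a / 12, r2 + a / 12, r1 + a / 12]"
    unfolding roots_def set_eq
    by (rule sorted_list_of_set_unique[THEN iffD1]) (use lt in auto)
  then have e: "e3 d K = r3 + a / 12" "e2 d K = r2 + a / 12" "e1 d K = r1 + a / 12"
    by (auto simp: e1_def e2_def e3_def)
  show "e3 d K < e2 d K" "e2 d K < e1 d K" using e lt by auto
  show "{X. cubic d K X = 0} = {e1 d K, e2 d K, e3 d K}" unfolding set_eq e by auto
  have "X_coord K - a / 12 = d" by (simp add: X_coord_def a_def A_def field_simps)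
  then show "nu d K > 0" using lt e by (simp add: nu_def)
qed

end

theory Submission
  imports Defs "HOL-Complex_Analysis.Complex_Analysis"
begin

text \<open>
  The curve is a real oval of an elliptic curve, and \<^const>\<open>F\<close> is the translation by a point of it. The
  argument makes this concrete with a flow. The cubic, as a function of \<open>(x, y)\<close>, is the Hamiltonian of a
  polynomial vector field tangent to the curve, and \<^const>\<open>F\<close> maps solutions of this field to solutions.
  Once the oval is covered by one periodic solution \<open>P\<close>, uniqueness of solutions forces
  \<open>F (P t) = P (t + c)\<close> as soon as \<open>F (P 0) = P c\<close>; so \<^const>\<open>F\<close> is conjugated to the rotation by \<open>2 * pi * c / T\<close>,
  where \<open>T\<close> is the period. What remains is to compute \<open>c\<close> and \<open>T\<close>.

  The computation rests on the symmetric function \<open>p = x * y\<close>. On the curve \<open>x + y = (K * p - d) / (p + 1)\<close>, and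
  \<open>q = (y - x) * (p + 1)\<close> satisfies \<open>q\<^sup>2 = (K * p - d)\<^sup>2 - 4 * p * (p + 1)\<^sup>2\<close>. The three roots of this cubic in \<open>p\<close> are the
  squares of the coordinates \<open>w1 < 0 < w2 < w3\<close> of the points of the full cubic curve on the diagonal \<open>x = y\<close>,
  and the affine change \<open>X = X_coord K - K * p\<close> turns it into \<^const>\<open>cubic\<close>, up to a constant factor; hence
  \<open>X_coord K - e\<^sub>i = K * w\<^sub>i\<^sup>2\<close>. With \<open>p = w3\<^sup>2 - (w3\<^sup>2 - w2\<^sup>2) * (sin \<psi>)\<^sup>2\<close> the flow becomes, after rescaling
  time, \<open>d\<psi>/dt = sqrt (1 - m * (sin \<psi>)\<^sup>2)\<close> with \<open>m = 1 - eps d K\<close>, so \<open>t\<close> is the elliptic integral of the first kind of \<open>\<psi>\<close>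
  and \<open>u = tan \<psi>\<close> produces \<^const>\<open>integrand\<close>. The angle \<open>\<psi>\<close> has period \<open>pi\<close>, which gives \<open>T\<close>. Starting at the
  diagonal point \<open>(w3, w3)\<close>, one application of \<^const>\<open>F\<close> leads to the point with
  \<open>(tan \<psi>)\<^sup>2 = (w3\<^sup>2 - w1\<^sup>2) / w1\<^sup>2 = (e1 - e3) / nu\<close>, up to the reflection \<open>\<psi> \<mapsto> - \<psi>\<close>, which only reverses the orientation of
  the circle. This gives \<open>c\<close>, and the key statements are \<open>flow_line_flow_point\<close>, \<open>F_flow_point\<close> and
  \<open>F_flow_point_0\<close>.

  For analyticity, the \<open>w\<^sub>i\<close> are local inverse branches of the single rational function
  \<open>w \<mapsto> 2 * w + 2 / w + d / w\<^sup>2\<close>, which assigns to a diagonal point its level \<open>K\<close>. Since these branches are simple, they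
  extend holomorphically to complex \<open>K\<close>. The two integrals, written over fixed compact intervals, are then
  holomorphic in the parameters, and so is their quotient.
\<close>

section \<open>The elliptic integral of the first kind and the amplitude\<close>

definition elliptic_integrand :: "real \<Rightarrow> real \<Rightarrow> real" where
  "elliptic_integrand m \<psi> = 1 / sqrt (1 - m * (sin \<psi>)\<^sup>2)"

text \<open>The incomplete elliptic integral of the first kind in Legendre's form, with parameter
  \<open>m\<close> (the square of the modulus); the two terms make it odd, one of them always being an integral
  over an empty or degenerate interval.\<close>

definition elliptic_F :: "real \<Rightarrow> real \<Rightarrow> real" where
  "elliptic_F m x = integral {0..x} (elliptic_integrand m) - integral {x..0} (elliptic_integrand m)"

text \<open>Jacobi's amplitude.\<close>

definition amplitude :: "real \<Rightarrow> real \<Rightarrow> real" where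
  "amplitude m = inv (elliptic_F m)"

lemma elliptic_radicand_bounds:
  assumes "0 \<le> m" "m < (1::real)"
  shows "0 < 1 - m * (sin \<psi>)\<^sup>2" "1 - m * (sin \<psi>)\<^sup>2 \<le> 1"
proof -
  have "m * (sin \<psi>)\<^sup>2 \<le> m * 1"
    using assms by (intro mult_left_mono) (auto simp: abs_square_le_1)
  then show "0 < 1 - m * (sin \<psi>)\<^sup>2" using assms by linarith
qed (use assms in simp)

lemma continuous_elliptic_integrand:
  assumes "0 \<le> m" "m < 1"
  shows "continuous_on S (elliptic_integrand m)"
proof -
  have "sqrt (1 - m * (sin \<psi>)\<^sup>2) \<noteq> 0" for \<psi>
    using elliptic_radicand_bounds(1)[OF assms, of \<psi>] by simp
  then show ?thesis unfolding elliptic_integrand_def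
    by (intro continuous_intros) auto
qed

lemma elliptic_integrand_ge_1:
  assumes "0 \<le> m" "m < 1"
  shows "1 \<le> elliptic_integrand m \<psi>"
  using elliptic_radicand_bounds[OF assms, of \<psi>] unfolding elliptic_integrand_def
  by (simp add: divide_simps)

text \<open>On a bounded window \<open>{-N..N}\<close> around \<open>x\<close> the function differs by a
  constant from the integral with fixed lower limit \<open>-N\<close>, so the fundamental theorem applies on
  both sides of \<open>0\<close> at once.\<close>

lemma DERIV_elliptic_F:
  assumes m: "0 \<le> m" "m < 1"
  shows "(elliptic_F m has_real_derivative elliptic_integrand m x) (at x)"
proof -
  let ?f = "elliptic_integrand m"
  define N where "N = \<bar>x\<bar> + 1"
  have int: "?f integrable_on {a..b}" for a b
    by (intro integrable_continuous_interval continuous_elliptic_integrand m)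
  have eq: "elliptic_F m y = integral {-N..y} ?f - integral {-N..0} ?f" if "y \<in> {-N<..<N}" for y
  proof (cases "y \<ge> 0")
    case True
    have "integral {-N..y} ?f = integral {-N..0} ?f + integral {0..y} ?f"
      by (rule Henstock_Kurzweil_Integration.integral_combine[symmetric]) (use True int in \<open>auto simp: N_def\<close>)
    moreover have "integral {y..0} ?f = 0"
      using True by (cases "y = 0") auto
    ultimately show ?thesis by (simp add: elliptic_F_def)
  next
    case False
    have "integral {-N..0} ?f = integral {-N..y} ?f + integral {y..0} ?f"
      by (rule Henstock_Kurzweil_Integration.integral_combine[symmetric]) (use that False int in \<open>auto simp: N_def\<close>)
    then show ?thesis using False by (simp add: elliptic_F_def)
  qed
  have x: "x \<in> {-N<..<N}" by (auto simp: N_def)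
  have "((\<lambda>u. integral {-N..u} ?f) has_real_derivative ?f x) (at x within {-N..N})"
    by (intro integral_has_real_derivative continuous_elliptic_integrand m) (use x in auto)
  then have "((\<lambda>u. integral {-N..u} ?f) has_real_derivative ?f x) (at x)"
    using x by (subst (asm) at_within_interior) auto
  then have "((\<lambda>u. integral {-N..u} ?f - integral {-N..0} ?f) has_real_derivative ?f x) (at x)"
    by (auto intro!: derivative_eq_intros)
  then show ?thesis
    by (rule DERIV_cong_ev[THEN iffD1, rotated -1])
       (use eq x in \<open>auto intro!: eventually_nhds_in_open[THEN eventually_mono, of "{-N<..<N}"]\<close>)
qed

lemma elliptic_F_0 [simp]: "elliptic_F m 0 = 0"
  by (simp add: elliptic_F_def)

lemma elliptic_F_pos_eq: "0 \<le> x \<Longrightarrow> elliptic_F m x = integral {0..x} (elliptic_integrand m)"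
  by (cases "x = 0") (auto simp: elliptic_F_def)

lemma elliptic_F_strict_mono:
  assumes "0 \<le> m" "m < 1"
  shows "strict_mono (elliptic_F m)"
proof (rule strict_monoI)
  fix x y :: real assume "x < y"
  then show "elliptic_F m x < elliptic_F m y"
    by (rule DERIV_pos_imp_increasing)
       (use DERIV_elliptic_F[OF assms] elliptic_integrand_ge_1[OF assms] in \<open>fastforce intro: less_le_trans[OF zero_less_one]\<close>)
qed

text \<open>The integrand has period \<open>pi\<close>, so both sides have the same derivative.\<close>

lemma elliptic_F_translate_pi:
  assumes m: "0 \<le> m" "m < 1"
  shows "elliptic_F m (x + pi) = elliptic_F m x + elliptic_F m pi"
proof -
  have "((\<lambda>x. elliptic_F m (x + pi) - elliptic_F m x) has_real_derivative 0) (at x)" for x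
  proof -
    have "((\<lambda>x. elliptic_F m (x + pi) - elliptic_F m x) has_real_derivative
       elliptic_integrand m (x + pi) - elliptic_integrand m x) (at x)"
      by (auto intro!: derivative_eq_intros DERIV_elliptic_F[OF m, THEN DERIV_chain2])
    then show ?thesis by (simp add: elliptic_integrand_def)
  qed
  then have "elliptic_F m (x + pi) - elliptic_F m x = elliptic_F m (0 + pi) - elliptic_F m 0"
    by (rule DERIV_isconst_all[OF allI])
  then show ?thesis by simp
qed

lemma elliptic_F_minus:
  assumes m: "0 \<le> m" "m < 1"
  shows "elliptic_F m (- x) = - elliptic_F m x"
proof -
  have "((\<lambda>x. elliptic_F m (- x) + elliptic_F m x) has_real_derivative 0) (at x)" for x
  proof -
    have "((\<lambda>x. elliptic_F m (- x) + elliptic_F m x) has_real_derivative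
       elliptic_integrand m (- x) * (-1) + elliptic_integrand m x) (at x)"
      by (intro DERIV_add DERIV_elliptic_F[OF m] DERIV_chain2[OF DERIV_elliptic_F[OF m]]) (auto intro!: derivative_eq_intros)
    then show ?thesis by (simp add: elliptic_integrand_def)
  qed
  then have "elliptic_F m (- x) + elliptic_F m x = elliptic_F m (- 0) + elliptic_F m 0"
    by (rule DERIV_isconst_all[OF allI])
  then show ?thesis by simp
qed

lemma elliptic_F_pi:
  assumes m: "0 \<le> m" "m < 1"
  shows "elliptic_F m pi = 2 * elliptic_F m (pi / 2)"
  using elliptic_F_translate_pi[OF m, of "- (pi / 2)"] elliptic_F_minus[OF m, of "pi / 2"] by simp

lemma elliptic_F_pos:
  assumes m: "0 \<le> m" "m < 1" and "0 < x"
  shows "0 < elliptic_F m x"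
  using strict_monoD[OF elliptic_F_strict_mono[OF m] \<open>0 < x\<close>] by simp

text \<open>The integrand is at least \<open>1\<close>, so the integral grows at least as fast as the identity
  and takes all values.\<close>

lemma elliptic_F_bij:
  assumes m: "0 \<le> m" "m < 1"
  shows "bij (elliptic_F m)"
proof (rule bijI)
  show "inj (elliptic_F m)" using elliptic_F_strict_mono[OF m] by (rule strict_mono_imp_inj_on)
  have cont: "continuous_on S (elliptic_F m)" for S
    by (meson DERIV_elliptic_F[OF m] DERIV_continuous continuous_at_imp_continuous_on)
  have mono: "elliptic_F m x - x \<le> elliptic_F m y - y" if "x \<le> y" for x y
  proof (rule DERIV_nonneg_imp_nondecreasing[OF that])
    fix z
    show "\<exists>D. ((\<lambda>x. elliptic_F m x - x) has_real_derivative D) (at z) \<and> 0 \<le> D"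
      by (rule exI[of _ "elliptic_integrand m z - 1"])
         (use elliptic_integrand_ge_1[OF m] in \<open>auto intro!: derivative_eq_intros DERIV_elliptic_F m\<close>)
  qed
  show "surj (elliptic_F m)"
    unfolding surj_def
  proof
    fix t :: real
    have "elliptic_F m (- \<bar>t\<bar>) \<le> t" "t \<le> elliptic_F m \<bar>t\<bar>"
      using mono[of 0 "\<bar>t\<bar>"] mono[of "- \<bar>t\<bar>" 0] by auto
    then show "\<exists>x. t = elliptic_F m x"
      using IVT'[of "elliptic_F m" "- \<bar>t\<bar>" t "\<bar>t\<bar>"] cont by force
  qed
qed

lemma elliptic_F_amplitude [simp]:
  assumes "0 \<le> m" "m < 1"
  shows "elliptic_F m (amplitude m t) = t"
  unfolding amplitude_def by (rule surj_f_inv_f[OF bij_is_surj[OF elliptic_F_bij[OF assms]]])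

lemma amplitude_elliptic_F [simp]:
  assumes "0 \<le> m" "m < 1"
  shows "amplitude m (elliptic_F m x) = x"
  unfolding amplitude_def by (rule inv_f_f[OF bij_is_inj[OF elliptic_F_bij[OF assms]]])

lemma amplitude_0:
  assumes "0 \<le> m" "m < 1"
  shows "amplitude m 0 = 0"
  using amplitude_elliptic_F[OF assms, of 0] by simp

lemma DERIV_amplitude:
  assumes m: "0 \<le> m" "m < 1"
  shows "(amplitude m has_real_derivative sqrt (1 - m * (sin (amplitude m t))\<^sup>2)) (at t)"
proof -
  have cF: "isCont (elliptic_F m) z" for z using DERIV_elliptic_F[OF m] by (rule DERIV_isCont)
  define y where "y = amplitude m t"
  have "isCont (amplitude m) (elliptic_F m y)"
    by (rule isCont_inverse_function[of 1]) (use m cF in auto)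
  then have "isCont (amplitude m) t" by (simp add: y_def m)
  moreover have "elliptic_integrand m (amplitude m t) \<noteq> 0"
    using elliptic_integrand_ge_1[OF m, of "amplitude m t"] by linarith
  ultimately have "(amplitude m has_real_derivative inverse (elliptic_integrand m (amplitude m t))) (at t)"
    by (intro DERIV_inverse_function[where f = "elliptic_F m" and a = "t - 1" and b = "t + 1"]
          DERIV_elliptic_F m) (use m in auto)
  then show ?thesis by (simp add: elliptic_integrand_def)
qed

text \<open>The substitution \<open>\<psi> = arctan u\<close> turns Legendre's form into the algebraic
  integrand, with \<open>m = 1 - \<epsilon>\<close>.\<close>

lemma DERIV_elliptic_F_arctan:
  assumes \<epsilon>: "0 < \<epsilon>" "\<epsilon> \<le> 1"
  shows "((\<lambda>u. elliptic_F (1 - \<epsilon>) (arctan u)) has_real_derivative integrand \<epsilon> u) (at u)"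
proof -
  have m: "0 \<le> 1 - \<epsilon>" "1 - \<epsilon> < 1" using \<epsilon> by auto
  have u: "0 < 1 + u\<^sup>2" by (simp add: add_pos_nonneg)
  have e: "1 - (1 - \<epsilon>) * (sin (arctan u))\<^sup>2 = (1 + \<epsilon> * u\<^sup>2) / (1 + u\<^sup>2)"
    using u by (simp add: sin_arctan power_divide field_simps)
  have "elliptic_integrand (1 - \<epsilon>) (arctan u) * inverse (1 + u\<^sup>2) = integrand \<epsilon> u"
  proof -
    define s where "s = sqrt (1 + u\<^sup>2)"
    have s: "s > 0" "1 + u\<^sup>2 = s\<^sup>2" using u by (auto simp: s_def)
    have "elliptic_integrand (1 - \<epsilon>) (arctan u) * inverse (1 + u\<^sup>2)
        = 1 / (sqrt (1 + \<epsilon> * u\<^sup>2) / s) * inverse (s\<^sup>2)"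
      unfolding elliptic_integrand_def e real_sqrt_divide s_def[symmetric] using s(2) by simp
    also have "\<dots> = 1 / (s * sqrt (1 + \<epsilon> * u\<^sup>2))"
      using s(1) by (simp add: power2_eq_square divide_simps)
    finally show ?thesis by (simp add: integrand_def real_sqrt_mult s_def)
  qed
  with DERIV_chain2[OF DERIV_elliptic_F[OF m] DERIV_arctan, of u] show ?thesis by simp
qed

lemma integral_integrand:
  assumes \<epsilon>: "0 < \<epsilon>" "\<epsilon> \<le> 1" and U: "0 \<le> U"
  shows "(integrand \<epsilon> has_integral elliptic_F (1 - \<epsilon>) (arctan U)) {0..U}"
  using fundamental_theorem_of_calculus[OF U,
     of "\<lambda>u. elliptic_F (1 - \<epsilon>) (arctan u)" "integrand \<epsilon>"]
    DERIV_elliptic_F_arctan[OF \<epsilon>]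
  by (simp add: has_real_derivative_iff_has_vector_derivative has_vector_derivative_at_within)

lemma integral_integrand_infinity:
  assumes \<epsilon>: "0 < \<epsilon>" "\<epsilon> \<le> 1"
  shows "(integrand \<epsilon> has_integral elliptic_F (1 - \<epsilon>) (pi / 2)) {0..}"
proof (rule has_integral_to_inf)
  have m: "0 \<le> 1 - \<epsilon>" "1 - \<epsilon> < 1" using \<epsilon> by auto
  show "integrand \<epsilon> integrable_on {0..y}" for y
    by (cases "0 \<le> y") (use integral_integrand[OF \<epsilon>] in auto)
  have "((\<lambda>u. elliptic_F (1 - \<epsilon>) (arctan u)) \<longlongrightarrow> elliptic_F (1 - \<epsilon>) (pi / 2)) at_top"
    by (rule isCont_tendsto_compose[OF DERIV_isCont[OF DERIV_elliptic_F[OF m]] tendsto_arctan_at_top])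
  then show "((\<lambda>y. integral {0..y} (integrand \<epsilon>)) \<longlongrightarrow> elliptic_F (1 - \<epsilon>) (pi / 2)) at_top"
    by (rule Lim_transform_eventually)
       (use integral_integrand[OF \<epsilon>, THEN integral_unique] in \<open>auto intro!: eventually_at_top_linorderI[of 0]\<close>)
  show "0 \<le> integrand \<epsilon> y" for y using \<epsilon> by (simp add: integrand_def)
qed

section \<open>Periodic parametrisations and rotations\<close>

text \<open>A closed curve covered periodically and otherwise injectively is a circle, by compactness of the
  circle, and a map that shifts the parameter becomes a rotation.\<close>

lemma conjugated_on_rotation_of_periodic_parametrisation:
  fixes P :: "real \<Rightarrow> 'a::t2_space"
  assumes T: "T > 0" and cont: "continuous_on UNIV P" and ran: "range P = S"
    and per: "\<And>t t'. P t = P t' \<longleftrightarrow> (\<exists>n::int. t' = t + n * T)"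
    and shift: "\<And>t. f (P t) = P (t + c)"
  shows "conjugated_on S f circle (rotation (2 * pi * (c / T)))"
proof -
  define g where "g z = P (T * Arg z / (2 * pi))" for z
  have g_cis: "g (cis s) = P (T * s / (2 * pi))" for s
  proof -
    have "cis (Arg (cis s)) = cis s" by (simp add: cis_Arg sgn_div_norm)
    then obtain n :: int where n: "s = Arg (cis s) + 2 * pi * n"
      by (metis sin_cos_eq_iff cis.sel)
    have "T * s / (2 * pi) = T * Arg (cis s) / (2 * pi) + n * T"
      by (subst n) (simp add: field_simps)
    then show ?thesis unfolding g_def per by blast
  qed
  have circle: "z \<in> circle \<longleftrightarrow> (\<exists>s. z = cis s)" for z
  proof
    assume "z \<in> circle"
    then have "norm z = 1" by (simp add: circle_def)
    then show "\<exists>s. z = cis s"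
      by (metis cis_Arg norm_zero zero_neq_one sgn_div_norm inverse_1 scaleR_one)
  qed (auto simp: circle_def)
  have cP: "isCont P t" for t using cont by (simp add: continuous_on_eq_continuous_at)
  \<comment> \<open>\<^const>\<open>Arg\<close> jumps on the negative axis, \<^const>\<open>Arg2pi\<close> on the positive one; periodicity makes both
    give the same map.\<close>
  have "isCont g z \<or> continuous (at z within circle) g" if "z \<in> circle" for z
  proof (cases "z \<in> \<real>\<^sub>\<le>\<^sub>0")
    case False
    then have "isCont (\<lambda>z. P (T * Arg z / (2 * pi))) z"
      by (intro isCont_o2[OF _ cP] continuous_intros continuous_at_Arg) auto
    then show ?thesis by (simp add: g_def[abs_def])
  next
    case True
    have "z \<noteq> 0" using that by (auto simp: circle_def)
    then have "z \<notin> \<real>\<^sub>\<ge>\<^sub>0" using True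
      by (auto simp: complex_nonpos_Reals_iff complex_nonneg_Reals_iff complex_eq_iff)
    then have c: "isCont (\<lambda>z. P (T * Arg2pi z / (2 * pi))) z"
      by (intro isCont_o2[OF _ cP] continuous_intros continuous_at_Arg2pi) auto
    have "g u = P (T * Arg2pi u / (2 * pi))" if "u \<in> circle" for u
    proof -
      have "u = cis (Arg2pi u)"
        using that Arg2pi_eq[of u] by (simp add: circle_def cis_conv_exp)
      then show ?thesis using g_cis[of "Arg2pi u"] by simp
    qed
    then have "continuous (at z within circle) g"
      by (intro continuous_transform_within[OF continuous_at_imp_continuous_at_within[OF c], of 1])
         (use that in auto)
    then show ?thesis ..
  qed
  then have gc: "continuous_on circle g"
    by (meson continuous_at_imp_continuous_at_within continuous_on_eq_continuous_within)
  have img: "g ` circle = S"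
  proof
    show "g ` circle \<subseteq> S" using ran by (auto simp: g_def)
    show "S \<subseteq> g ` circle"
    proof
      fix x assume "x \<in> S"
      then obtain t where "x = P t" using ran by auto
      then have "x = g (cis (2 * pi * t / T))" using T by (simp add: g_cis)
      then show "x \<in> g ` circle" using circle by blast
    qed
  qed
  \<comment> \<open>Two angles with the same image differ by a whole number of turns, by the hypothesis on the
    periods.\<close>
  have inj: "inj_on g circle"
  proof (rule inj_onI)
    fix u v assume uv: "u \<in> circle" "v \<in> circle" "g u = g v"
    then obtain s t where st: "u = cis s" "v = cis t" by (auto simp: circle)
    then obtain n :: int where "T * t / (2 * pi) = T * s / (2 * pi) + n * T"
      using uv(3) by (auto simp: g_cis per)
    then have "T * t = T * (s + 2 * pi * n)" by (simp add: field_simps)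
    then have "t = s + 2 * pi * n" using T by simp
    then show "u = v" using st sin_cos_eq_iff[of t s] by (auto simp: cis.ctr)
  qed
  obtain h where "homeomorphism circle S g h"
    using homeomorphism_compact[OF _ gc img inj] by (auto simp: circle_def)
  then have hom: "homeomorphism S circle h g" by (rule homeomorphism_symD)
  have hg: "h (g z) = z" if "z \<in> circle" for z
    using \<open>homeomorphism circle S g h\<close> that by (auto simp: homeomorphism_def)
  have "h (f x) = rotation (2 * pi * (c / T)) (h x)" if x: "x \<in> S" for x
  proof -
    obtain z where z: "z \<in> circle" "x = g z" using x img by auto
    then obtain s where s: "z = cis s" by (auto simp: circle)
    have "T * (2 * pi * (c / T) + s) / (2 * pi) = T * s / (2 * pi) + c"
      using T by (simp add: distrib_left add_divide_distrib)
    then have "f x = g (cis (2 * pi * (c / T) + s))"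
      by (simp add: z s g_cis shift)
    moreover have "cis (2 * pi * (c / T) + s) \<in> circle" by (auto simp: circle)
    ultimately have "h (f x) = cis (2 * pi * (c / T) + s)" by (simp add: hg)
    moreover have "h x = cis s" using hg[OF z(1)] by (simp add: z(2) s)
    ultimately show ?thesis by (simp add: rotation_def cis_mult)
  qed
  moreover have "f ` S \<subseteq> S" using ran shift by force
  moreover have "rotation (2 * pi * (c / T)) ` circle \<subseteq> circle"
    by (auto simp: rotation_def circle_def norm_mult)
  ultimately show ?thesis unfolding conjugated_on_def using hom by blast
qed

section \<open>The Hamiltonian flow and its symmetries\<close>

text \<open>Integral curves of \<open>c\<close> times the Hamiltonian vector field of \<open>f (x, y) = x * y *
  (x + y) + (x + y) + d - K * (x * y)\<close>, that is \<open>x' = c * f\<^sub>y\<close> and \<open>y' = - c *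
  f\<^sub>x\<close>.\<close>

definition flow_line :: "real \<Rightarrow> real \<Rightarrow> (real \<Rightarrow> real \<times> real) \<Rightarrow> bool" where
  "flow_line c K z \<longleftrightarrow> (\<forall>t.
     ((\<lambda>t. fst (z t)) has_real_derivative
        c * ((fst (z t))\<^sup>2 + 2 * fst (z t) * snd (z t) + 1 - K * fst (z t))) (at t) \<and>
     ((\<lambda>t. snd (z t)) has_real_derivative
        - c * ((snd (z t))\<^sup>2 + 2 * fst (z t) * snd (z t) + 1 - K * snd (z t))) (at t))"

lemma flow_line_translate:
  assumes "flow_line c K z"
  shows "flow_line c K (\<lambda>t. z (t + a))"
  using assms DERIV_shift[of "\<lambda>t. fst (z t)" _ _ a] DERIV_shift[of "\<lambda>t. snd (z t)" _ _ a]
  unfolding flow_line_def by blast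

text \<open>Gronwall's argument: \<open>D t * exp (- L * t)\<close> decreases to the right of \<open>a\<close>
  and \<open>D t * exp (L * t)\<close> increases to the left of it.\<close>

lemma zero_of_differential_inequality:
  fixes D D' :: "real \<Rightarrow> real"
  assumes D: "\<And>t. (D has_real_derivative D' t) (at t)" and nonneg: "\<And>t. 0 \<le> D t"
    and bound: "\<And>t. \<bar>D' t\<bar> \<le> L * D t" and "D a = 0"
  shows "D t = 0"
proof -
  have "D t * exp (- L * t) \<le> D a * exp (- L * a)" if "a \<le> t"
  proof (rule DERIV_nonpos_imp_nonincreasing[OF that])
    fix s
    have "((\<lambda>t. D t * exp (- L * t)) has_real_derivative (D' s - L * D s) * exp (- L * s)) (at s)"
      by (auto intro!: derivative_eq_intros D simp: algebra_simps)
    moreover have "(D' s - L * D s) * exp (- L * s) \<le> 0"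
      using bound[of s] by (auto simp: mult_le_0_iff)
    ultimately show "\<exists>y. ((\<lambda>t. D t * exp (- L * t)) has_real_derivative y) (at s) \<and> y \<le> 0" by blast
  qed
  moreover have "D t * exp (L * t) \<le> D a * exp (L * a)" if "t \<le> a"
  proof (rule DERIV_nonneg_imp_nondecreasing[OF that])
    fix s
    have "((\<lambda>t. D t * exp (L * t)) has_real_derivative (D' s + L * D s) * exp (L * s)) (at s)"
      by (auto intro!: derivative_eq_intros D simp: algebra_simps)
    moreover have "0 \<le> (D' s + L * D s) * exp (L * s)"
      using bound[of s] by (auto simp: zero_le_mult_iff)
    ultimately show "\<exists>y. ((\<lambda>t. D t * exp (L * t)) has_real_derivative y) (at s) \<and> 0 \<le> y" by blast
  qed
  ultimately have "D t \<le> 0" using \<open>D a = 0\<close> by (cases "a \<le> t") (auto simp: mult_le_0_iff)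
  with nonneg[of t] show ?thesis by simp
qed

text \<open>On the square the quadratic vector field is Lipschitz, which bounds the derivative of the squared
  distance of two solutions by a multiple of that squared distance.\<close>

lemma flow_line_unique:
  assumes z: "flow_line c K z" and w: "flow_line c K w"
    and bz: "\<And>t. z t \<in> {0..K} \<times> {0..K}" and bw: "\<And>t. w t \<in> {0..K} \<times> {0..K}"
    and "z a = w a"
  shows "z t = w t"
proof -
  define x y u v where "x = (\<lambda>t. fst (z t))" "y = (\<lambda>t. snd (z t))" "u = (\<lambda>t. fst (w t))" "v = (\<lambda>t. snd (w t))"
  note defs = this
  have b: "0 \<le> x t" "x t \<le> K" "0 \<le> y t" "y t \<le> K" "0 \<le> u t" "u t \<le> K" "0 \<le> v t" "v t \<le> K" for t
    using bz[of t] bw[of t] by (auto simp: defs mem_Times_iff)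
  have dx: "(x has_real_derivative c * ((x t)\<^sup>2 + 2 * x t * y t + 1 - K * x t)) (at t)"
   and dy: "(y has_real_derivative - c * ((y t)\<^sup>2 + 2 * x t * y t + 1 - K * y t)) (at t)"
   and du: "(u has_real_derivative c * ((u t)\<^sup>2 + 2 * u t * v t + 1 - K * u t)) (at t)"
   and dv: "(v has_real_derivative - c * ((v t)\<^sup>2 + 2 * u t * v t + 1 - K * v t)) (at t)" for t
    using z w by (auto simp: flow_line_def defs)
  define D where "D t = (x t - u t)\<^sup>2 + (y t - v t)\<^sup>2" for t
  define D' where "D' t = 2 * c * ((x t + u t + 2 * y t - K) * (x t - u t)\<^sup>2
     + 2 * (u t - v t) * ((x t - u t) * (y t - v t)) - (y t + v t + 2 * x t - K) * (y t - v t)\<^sup>2)" for t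
  have "D t = 0"
  proof (rule zero_of_differential_inequality[of D D' "8 * \<bar>c\<bar> * K"])
    show "(D has_real_derivative D' t) (at t)" for t
      unfolding D_def[abs_def] D'_def
      apply (rule derivative_eq_intros dx dy du dv refl)+
      apply (simp add: power2_eq_square algebra_simps)
      done
    show "D a = 0" using \<open>z a = w a\<close> by (simp add: D_def defs)
    show "0 \<le> D t" for t by (simp add: D_def)
    show "\<bar>D' t\<bar> \<le> 8 * \<bar>c\<bar> * K * D t" for t
    proof -
      define p q where "p = x t - u t" "q = y t - v t"
      have pq: "\<bar>p * q\<bar> \<le> (p\<^sup>2 + q\<^sup>2) / 2"
        using sum_squares_bound[of "\<bar>p\<bar>" "\<bar>q\<bar>"] by (simp add: abs_mult)
      have 1: "\<bar>(x t + u t + 2 * y t - K) * p\<^sup>2\<bar> \<le> 3 * K * p\<^sup>2"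
        unfolding abs_mult by (rule mult_mono) (use b[of t] in auto)
      have 2: "\<bar>(y t + v t + 2 * x t - K) * q\<^sup>2\<bar> \<le> 3 * K * q\<^sup>2"
        unfolding abs_mult by (rule mult_mono) (use b[of t] in auto)
      have 3: "\<bar>2 * (u t - v t) * (p * q)\<bar> \<le> 2 * K * ((p\<^sup>2 + q\<^sup>2) / 2)"
        unfolding abs_mult[of "2 * (u t - v t)"] by (rule mult_mono) (use b[of t] pq in auto)
      have "\<bar>(x t + u t + 2 * y t - K) * p\<^sup>2 + 2 * (u t - v t) * (p * q)
          - (y t + v t + 2 * x t - K) * q\<^sup>2\<bar> \<le> 4 * K * (p\<^sup>2 + q\<^sup>2)"
      proof -
        have "\<bar>a + b - e\<bar> \<le> 4 * K * (r + s)"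
          if "\<bar>a\<bar> \<le> 3 * K * r" "\<bar>b\<bar> \<le> 2 * K * ((r + s) / 2)" "\<bar>e\<bar> \<le> 3 * K * s" for a b e r s
        proof -
          have "4 * K * (r + s) = 3 * K * r + 2 * K * ((r + s) / 2) + 3 * K * s" by algebra
          then show ?thesis using that by linarith
        qed
        from this[OF 1 3 2] show ?thesis .
      qed
      then have "2 * \<bar>c\<bar> * \<bar>(x t + u t + 2 * y t - K) * p\<^sup>2 + 2 * (u t - v t) * (p * q)
          - (y t + v t + 2 * x t - K) * q\<^sup>2\<bar> \<le> 2 * \<bar>c\<bar> * (4 * K * (p\<^sup>2 + q\<^sup>2))"
        by (intro mult_left_mono) auto
      then show ?thesis by (simp add: D'_def D_def p_q_def abs_mult)
    qed
  qed
  then show ?thesis by (simp add: D_def sum_power2_eq_zero_iff defs prod_eq_iff)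
qed

text \<open>For fixed \<open>y\<close> the curve has two points, which a horizontal switch exchanges.
  \<^const>\<open>F\<close> is a horizontal switch followed by a vertical one; the two are conjugate under the
  reflection in the diagonal, so \<^const>\<open>F\<close> is the square of a horizontal switch followed by that
  reflection.\<close>

definition half_F :: "real \<Rightarrow> real \<times> real \<Rightarrow> real \<times> real" where
  "half_F d = (\<lambda>(x, y). (y, (y + d) / (x * y)))"

lemma F_eq_half_F_twice:
  assumes "d > 0" "x > 0" "y > 0"
  shows "F d (x, y) = half_F d (half_F d (x, y))"
proof -
  have "(d * a + b) / (y * b) = (b / a + d) / (y * (b / a))" if "a > 0" "b > 0" for a b
    using that assms by (simp add: field_simps)
  from this[of "x * y" "y + d"] show ?thesis
    using assms by (simp add: F_def half_F_def add.assoc mult.assoc)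
qed

lemma C_plus_iff:
  "(x, y) \<in> C_plus d K \<longleftrightarrow> x > 0 \<and> y > 0 \<and> x * y * (x + y) + (x + y) + d = K * (x * y)"
proof -
  have "G d (x, y) = K \<longleftrightarrow> x * y * (x + y) + (x + y) + d = K * (x * y)" if "x > 0" "y > 0"
    using that by (simp add: G_def divide_simps) (auto simp: algebra_simps)
  then show ?thesis by (auto simp: C_plus_def)
qed

text \<open>On the curve the horizontal switch is affine in \<open>x\<close>: the two abscissae at height
  \<open>y\<close> have sum \<open>K - y - 1 / y\<close>. This form is the one that is easily
  differentiated.\<close>

lemma half_F_on_C_plus:
  assumes "(x, y) \<in> C_plus d K"
  shows "half_F d (x, y) = (y, K - y - 1 / y - x)"
proof -
  have xy: "x > 0" "y > 0" "x * y * (x + y) + (x + y) + d = K * (x * y)"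
    using assms by (auto simp: C_plus_iff)
  have "(K - y - 1 / y - x) * (x * y) = y + d"
    using xy(1,2) by (simp add: field_simps) (use xy(3) in algebra)
  then show ?thesis using xy by (simp add: half_F_def divide_simps)
qed

lemma half_F_C_plus:
  assumes "d > 0" "z \<in> C_plus d K"
  shows "half_F d z \<in> C_plus d K"
proof -
  obtain x y where z: "z = (x, y)" by fastforce
  have xy: "x > 0" "y > 0" "x * y * (x + y) + (x + y) + d = K * (x * y)"
    using assms by (auto simp: C_plus_iff z)
  define v where "v = (y + d) / (x * y)"
  have v: "v > 0" "x * y * v = y + d" using xy assms by (auto simp: v_def)
  have "y * (y * v * (y + v) + (y + v) + d - K * (y * v)) * x = 0"
    using v(2) xy(3) by algebra
  then have "y * v * (y + v) + (y + v) + d = K * (y * v)" using xy by simp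
  then show ?thesis using xy v by (simp add: z half_F_def v_def[symmetric] C_plus_iff)
qed

text \<open>The reflection in the diagonal and the horizontal switch both reverse the Hamiltonian flow: the
  first because it preserves \<open>f\<close> and reverses orientation, the second because a quadratic has
  opposite slopes at its two roots. Their product therefore preserves the flow.\<close>

lemma flow_line_half_F:
  assumes z: "flow_line c K z" and C: "\<And>t. z t \<in> C_plus d K"
  shows "flow_line c K (\<lambda>t. half_F d (z t))"
proof -
  define x y where "x = (\<lambda>t. fst (z t))" "y = (\<lambda>t. snd (z t))"
  note defs = this
  have zt: "z t = (x t, y t)" for t by (simp add: defs)
  have y: "y t > 0" for t using C[of t] by (auto simp: zt C_plus_iff)
  have dx: "(x has_real_derivative c * ((x t)\<^sup>2 + 2 * x t * y t + 1 - K * x t)) (at t)"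
   and dy: "(y has_real_derivative - c * ((y t)\<^sup>2 + 2 * x t * y t + 1 - K * y t)) (at t)" for t
    using z by (auto simp: flow_line_def defs)
  define v where "v t = K - y t - 1 / y t - x t" for t
  have h: "half_F d (z t) = (y t, v t)" for t
    using half_F_on_C_plus[of "x t" "y t"] C[of t] by (simp add: zt v_def)
  have 1: "- c * ((y t)\<^sup>2 + 2 * x t * y t + 1 - K * y t)
      = c * ((y t)\<^sup>2 + 2 * y t * v t + 1 - K * y t)" for t
    unfolding v_def using y[of t] by (simp add: field_simps power2_eq_square)
  have "(v has_real_derivative - c * ((v t)\<^sup>2 + 2 * y t * v t + 1 - K * v t)) (at t)" for t
  proof -
    define i where "i = 1 / y t"
    have i: "y t * i = 1" using y[of t] by (simp add: i_def)
    have v: "v t = K - y t - i - x t" by (simp add: v_def i_def)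
    have "(v has_real_derivative
       c * ((y t)\<^sup>2 + 2 * x t * y t + 1 - K * y t) * (1 - i\<^sup>2)
       - c * ((x t)\<^sup>2 + 2 * x t * y t + 1 - K * x t)) (at t)"
      unfolding v_def[abs_def]
      by (rule derivative_eq_intros dx dy refl | use y[of t] in force)+
         (use y[of t] in \<open>simp add: i_def power2_eq_square field_simps\<close>)
    moreover have "c * ((y t)\<^sup>2 + 2 * x t * y t + 1 - K * y t) * (1 - i\<^sup>2)
       - c * ((x t)\<^sup>2 + 2 * x t * y t + 1 - K * x t)
       = - c * ((v t)\<^sup>2 + 2 * y t * v t + 1 - K * v t)"
      using i v by algebra
    ultimately show ?thesis by simp
  qed
  with dy show ?thesis unfolding flow_line_def h 1 by (simp add: defs)
qed

section \<open>Uniformisation of the curve\<close>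

text \<open>The diagonal \<open>x = y = w\<close> meets the cubic curve where \<open>2 * w ^ 3 - K * w\<^sup>2 +
  2 * w + d = 0\<close>. All data of the curve are expressed in the three solutions; their elementary symmetric
  functions determine \<open>K\<close> and \<open>d\<close>.\<close>

locale diagonal_roots =
  fixes d K w1 w2 w3 :: real
  assumes w1: "w1 < 0" and w12: "- w1 < w2" and w23: "w2 < w3"
    and vieta: "2 * (w1 + w2 + w3) = K" "w1 * w2 + w1 * w3 + w2 * w3 = 1" "- 2 * (w1 * w2 * w3) = d"
begin

lemma d_pos: "d > 0" and K_pos: "K > 0"
proof -
  have "w1 * w2 * w3 < 0" using w1 w12 w23 by (simp add: mult_less_0_iff)
  then show "d > 0" using vieta by simp
  show "K > 0" using vieta(1) w1 w12 w23 by simp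
qed

lemma diagonal_root_iff: "K * w\<^sup>2 = 2 * w ^ 3 + 2 * w + d \<longleftrightarrow> w \<in> {w1, w2, w3}"
proof -
  have "2 * w ^ 3 - 2 * (w1 + w2 + w3) * w\<^sup>2 + 2 * (w1 * w2 + w1 * w3 + w2 * w3) * w - 2 * (w1 * w2 * w3)
     = 2 * ((w - w1) * (w - w2) * (w - w3))" by algebra
  then have "2 * w ^ 3 - K * w\<^sup>2 + 2 * 1 * w + d = 2 * ((w - w1) * (w - w2) * (w - w3))"
    unfolding vieta(1,2) using vieta(3) by simp
  then show ?thesis by auto
qed

lemmas diagonal_root = diagonal_root_iff[THEN iffD2]

lemma squares: "0 < w1\<^sup>2" "w1\<^sup>2 < w2\<^sup>2" "w2\<^sup>2 < w3\<^sup>2"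
  using w1 power_strict_mono[of "- w1" w2 2] power_strict_mono[of w2 w3 2] w12 w23 by auto

definition m where "m = (w3\<^sup>2 - w2\<^sup>2) / (w3\<^sup>2 - w1\<^sup>2)"

definition \<kappa> where "\<kappa> = sqrt (w3\<^sup>2 - w1\<^sup>2)"

lemma kappa: "\<kappa> > 0" "\<kappa>\<^sup>2 = w3\<^sup>2 - w1\<^sup>2" "m * \<kappa>\<^sup>2 = w3\<^sup>2 - w2\<^sup>2"
  using squares by (auto simp: \<kappa>_def m_def)

lemma m: "0 \<le> m" "m < 1"
  using squares by (auto simp: m_def divide_simps)

text \<open>With \<open>s = x + y\<close> the left-hand side is \<open>((y - x) * (p + 1))\<^sup>2\<close> on
  the curve. It factors because it vanishes when \<open>x = y\<close>, and then \<open>p\<close> is the square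
  of a diagonal coordinate.\<close>

lemma product_cubic_factored:
  "(K * p - d)\<^sup>2 - 4 * p * (p + 1)\<^sup>2 = 4 * (p - w1\<^sup>2) * (p - w2\<^sup>2) * (w3\<^sup>2 - p)"
proof -
  have "(2 * (w1 + w2 + w3) * p - - 2 * (w1 * w2 * w3))\<^sup>2 - 4 * p * (p + (w1 * w2 + w1 * w3 + w2 * w3))\<^sup>2
    = 4 * (p - w1\<^sup>2) * (p - w2\<^sup>2) * (w3\<^sup>2 - p)"
    by algebra
  then show ?thesis unfolding vieta .
qed

definition product :: "real \<Rightarrow> real" where
  "product \<psi> = w3\<^sup>2 - (w3\<^sup>2 - w2\<^sup>2) * (sin \<psi>)\<^sup>2"

text \<open>The square root \<open>(y - x) * (x * y + 1)\<close> of the cubic in \<^term>\<open>product\<close>,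
  with the sign that makes it \<open>\<kappa>\<close> times the derivative of \<^term>\<open>product\<close>
  along the amplitude.\<close>

definition weighted_gap :: "real \<Rightarrow> real" where
  "weighted_gap \<psi> = - 2 * (w3\<^sup>2 - w2\<^sup>2) * sin \<psi> * cos \<psi> * \<kappa> * sqrt (1 - m * (sin \<psi>)\<^sup>2)"

text \<open>The point recovered from its product \<open>p\<close> and its weighted gap: its coordinates have sum
  \<open>(K * p - d) / (p + 1)\<close> by the equation of the curve.\<close>

definition curve_point :: "real \<Rightarrow> real \<times> real" where
  "curve_point \<psi> = (let p = product \<psi>; s = (K * p - d) / (p + 1); \<delta> = weighted_gap \<psi> / (p + 1)
          in ((s - \<delta>) / 2, (s + \<delta>) / 2))"

lemma product_bounds: "w2\<^sup>2 \<le> product \<psi>" "product \<psi> \<le> w3\<^sup>2" "0 < product \<psi>"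
proof -
  have "(w3\<^sup>2 - w2\<^sup>2) * (sin \<psi>)\<^sup>2 \<le> (w3\<^sup>2 - w2\<^sup>2) * 1"
    using squares by (intro mult_left_mono) (auto simp: abs_square_le_1)
  then show "w2\<^sup>2 \<le> product \<psi>" by (simp add: product_def)
  then show "0 < product \<psi>" using squares by linarith
  show "product \<psi> \<le> w3\<^sup>2" using squares by (simp add: product_def)
qed

lemma product_differences:
  "product \<psi> - w1\<^sup>2 = \<kappa>\<^sup>2 * (1 - m * (sin \<psi>)\<^sup>2)"
  "product \<psi> - w2\<^sup>2 = (w3\<^sup>2 - w2\<^sup>2) * (cos \<psi>)\<^sup>2"
  "w3\<^sup>2 - product \<psi> = (w3\<^sup>2 - w2\<^sup>2) * (sin \<psi>)\<^sup>2"
proof -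
  have "\<kappa>\<^sup>2 * (1 - m * (sin \<psi>)\<^sup>2) = \<kappa>\<^sup>2 - (m * \<kappa>\<^sup>2) * (sin \<psi>)\<^sup>2" by algebra
  also have "\<dots> = (w3\<^sup>2 - w1\<^sup>2) - (w3\<^sup>2 - w2\<^sup>2) * (sin \<psi>)\<^sup>2"
    unfolding kappa(3) unfolding kappa(2) ..
  finally show "product \<psi> - w1\<^sup>2 = \<kappa>\<^sup>2 * (1 - m * (sin \<psi>)\<^sup>2)"
    by (simp add: product_def)
qed (simp_all add: product_def cos_squared_eq algebra_simps)

lemma weighted_gap_squared: "(weighted_gap \<psi>)\<^sup>2 = (K * product \<psi> - d)\<^sup>2 - 4 * product \<psi> * (product \<psi> + 1)\<^sup>2"
proof -
  have "(weighted_gap \<psi>)\<^sup>2 = 4 * (w3\<^sup>2 - w2\<^sup>2)\<^sup>2 * (sin \<psi>)\<^sup>2 * (cos \<psi>)\<^sup>2 * \<kappa>\<^sup>2 * (sqrt (1 - m * (sin \<psi>)\<^sup>2))\<^sup>2"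
    unfolding weighted_gap_def by algebra
  also have "(sqrt (1 - m * (sin \<psi>)\<^sup>2))\<^sup>2 = 1 - m * (sin \<psi>)\<^sup>2"
    using elliptic_radicand_bounds[OF m, of \<psi>] by simp
  also have "4 * (w3\<^sup>2 - w2\<^sup>2)\<^sup>2 * (sin \<psi>)\<^sup>2 * (cos \<psi>)\<^sup>2 * \<kappa>\<^sup>2 * (1 - m * (sin \<psi>)\<^sup>2)
     = 4 * (product \<psi> - w1\<^sup>2) * (product \<psi> - w2\<^sup>2) * (w3\<^sup>2 - product \<psi>)"
    unfolding product_differences by algebra
  finally show ?thesis by (simp add: product_cubic_factored)
qed

lemma curve_point_props:
  fixes \<psi>
  defines "x \<equiv> fst (curve_point \<psi>)" and "y \<equiv> snd (curve_point \<psi>)"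
  shows "x * y = product \<psi>" "(x + y) * (product \<psi> + 1) = K * product \<psi> - d" "(y - x) * (product \<psi> + 1) = weighted_gap \<psi>"
proof -
  let ?p = "product \<psi>"
  have N: "?p + 1 > 0" using product_bounds(3)[of \<psi>] by simp
  have "(a - b) / 2 + (a + b) / 2 = a" "(a + b) / 2 - (a - b) / 2 = b" for a b :: real
    by (simp_all add: field_simps)
  then have "x + y = (K * ?p - d) / (?p + 1)" "y - x = weighted_gap \<psi> / (?p + 1)"
    unfolding x_def y_def curve_point_def Let_def fst_conv snd_conv by blast+
  then show s: "(x + y) * (?p + 1) = K * ?p - d" and dd: "(y - x) * (?p + 1) = weighted_gap \<psi>"
    using N by simp_all
  have "(x * y - ?p) * (?p + 1)\<^sup>2 * 4 = 0"
    using s dd weighted_gap_squared[of \<psi>] by algebra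
  then show "x * y = ?p" using N by simp
qed

text \<open>Positivity comes from \<open>p \<ge> w2\<^sup>2\<close>: there \<open>K * p \<ge> K * w2\<^sup>2 >
  d\<close>, so the sum of the coordinates is positive as well as their product.\<close>

lemma curve_point_in_C_plus: "curve_point \<psi> \<in> C_plus d K"
proof -
  define x y p where "x = fst (curve_point \<psi>)" "y = snd (curve_point \<psi>)" "p = product \<psi>"
  note pr = curve_point_props[of \<psi>, folded x_y_p_def]
  have p: "p > 0" using product_bounds(3) by (simp add: x_y_p_def)
  have "K * p \<ge> K * w2\<^sup>2" using product_bounds(1) K_pos by (simp add: x_y_p_def)
  moreover have "K * w2\<^sup>2 > d" using diagonal_root[of w2] w1 w12 by (simp add: add_pos_pos)
  ultimately have "x + y > 0" using pr(2) p by (metis diff_gt_0_iff_gt less_le_trans zero_less_mult_pos2 add_pos_pos zero_less_one)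
  moreover have "x * y > 0" using pr(1) p by simp
  ultimately have "x > 0" "y > 0" by (auto simp: zero_less_mult_iff)
  moreover have "x * y * (x + y) + (x + y) + d = K * (x * y)"
    using pr(2) unfolding pr(1) by (simp add: algebra_simps)
  ultimately have "(x, y) \<in> C_plus d K" by (simp add: C_plus_iff)
  then show ?thesis by (simp add: x_y_p_def)
qed

text \<open>The equation of the curve determines the sum of the coordinates from their product.\<close>

lemma C_plus_same_product:
  assumes "(x, y) \<in> C_plus d K" "(u, v) \<in> C_plus d K" "x * y = u * v"
  shows "(u, v) = (x, y) \<or> (u, v) = (y, x)"
proof -
  have "(x + y) * (x * y + 1) = (u + v) * (x * y + 1)" "x * y > 0"
    using assms by (auto simp: C_plus_iff algebra_simps)
  then have "x + y = u + v" by simp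
  then have "(u - x) * (u - y) = 0" using assms(3) by algebra
  then show ?thesis using \<open>x + y = u + v\<close> by auto
qed

text \<open>Product and weighted gap together carry exactly \<open>cos (2 * \<psi>)\<close> and \<open>sin (2 *
  \<psi>)\<close>.\<close>

lemma curve_point_eq_iff: "curve_point \<psi> = curve_point \<psi>' \<longleftrightarrow> (\<exists>n::int. \<psi>' = \<psi> + n * pi)"
proof
  assume eq: "curve_point \<psi> = curve_point \<psi>'"
  have p: "product \<psi> = product \<psi>'" using curve_point_props(1)[of \<psi>] curve_point_props(1)[of \<psi>'] eq by simp
  have q: "weighted_gap \<psi> = weighted_gap \<psi>'" using curve_point_props(3)[of \<psi>] curve_point_props(3)[of \<psi>'] eq p by simp
  have s: "(sin \<psi>)\<^sup>2 = (sin \<psi>')\<^sup>2" using p squares by (simp add: product_def)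
  have "sin \<psi> * cos \<psi> = sin \<psi>' * cos \<psi>'"
    using q squares kappa(1) elliptic_radicand_bounds(1)[OF m, of \<psi>'] unfolding weighted_gap_def s by simp
  with s have "sin (2 * \<psi>) = sin (2 * \<psi>')" "cos (2 * \<psi>) = cos (2 * \<psi>')"
    by (simp_all add: sin_double cos_double cos_squared_eq)
  then obtain n :: int where "2 * \<psi>' = 2 * \<psi> + 2 * pi * n"
    by (metis sin_cos_eq_iff)
  then have "2 * \<psi>' = 2 * (\<psi> + n * pi)" by (simp add: algebra_simps)
  then show "\<exists>n::int. \<psi>' = \<psi> + n * pi" by (intro exI[of _ n]) simp
next
  assume "\<exists>n::int. \<psi>' = \<psi> + n * pi"
  then obtain n :: int where n: "\<psi>' = \<psi> + n * pi" ..
  have "sin (2 * \<psi>) = sin (2 * \<psi>') \<and> cos (2 * \<psi>) = cos (2 * \<psi>')"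
    unfolding sin_cos_eq_iff by (rule exI[of _ "- n"]) (simp add: n)
  then have sc: "sin \<psi> * cos \<psi> = sin \<psi>' * cos \<psi>'" and s: "(sin \<psi>)\<^sup>2 = (sin \<psi>')\<^sup>2"
    by (simp_all add: sin_double cos_double cos_squared_eq)
  have "product \<psi> = product \<psi>'" by (simp add: product_def s)
  moreover have "weighted_gap \<psi> = weighted_gap \<psi>'"
    using sc unfolding weighted_gap_def s by (simp add: mult.assoc)
  ultimately show "curve_point \<psi> = curve_point \<psi>'" by (simp add: curve_point_def)
qed

lemma curve_point_minus: "curve_point (- \<psi>) = prod.swap (curve_point \<psi>)"
  by (simp add: curve_point_def Let_def product_def weighted_gap_def)

text \<open>The cubic in \<open>p = x * y\<close> is a square on the curve, hence nonnegative, which leaves two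
  intervals of \<open>p\<close>; positivity of \<open>x + y\<close> gives \<open>K * p > d > K *
  w1\<^sup>2\<close> and excludes the unbounded one.\<close>

lemma C_plus_product_bounds:
  assumes "(x, y) \<in> C_plus d K"
  shows "w2\<^sup>2 \<le> x * y" "x * y \<le> w3\<^sup>2"
proof -
  define p where "p = x * y"
  have xy: "x > 0" "y > 0" "x * y * (x + y) + (x + y) + d = K * (x * y)"
    using assms by (auto simp: C_plus_iff)
  have p: "p > 0" using xy by (simp add: p_def)
  have s: "(x + y) * (p + 1) = K * p - d" using xy(3) unfolding p_def by algebra
  have "K * p > d" using s xy p by (metis add_pos_pos diff_gt_0_iff_gt mult_pos_pos zero_less_one)
  moreover have "K * w1\<^sup>2 < d"
  proof -
    have "w1 ^ 3 < 0" using w1 by simp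
    moreover have "K * w1\<^sup>2 = 2 * w1 ^ 3 + 2 * w1 + d" by (rule diagonal_root) simp
    ultimately show ?thesis using w1 by linarith
  qed
  ultimately have "K * w1\<^sup>2 < K * p" by simp
  then have p1: "w1\<^sup>2 < p" using K_pos by simp
  have "0 \<le> ((y - x) * (p + 1))\<^sup>2" by simp
  also have "((y - x) * (p + 1))\<^sup>2 = (K * p - d)\<^sup>2 - 4 * p * (p + 1)\<^sup>2"
    using s p_def by algebra
  finally have "0 \<le> 4 * (p - w1\<^sup>2) * ((p - w2\<^sup>2) * (w3\<^sup>2 - p))"
    unfolding product_cubic_factored by (simp add: mult.assoc)
  then have "0 \<le> (p - w2\<^sup>2) * (w3\<^sup>2 - p)" using p1 by (simp add: zero_le_mult_iff)
  then show "w2\<^sup>2 \<le> x * y" "x * y \<le> w3\<^sup>2"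
    using squares by (auto simp: zero_le_mult_iff p_def[symmetric])
qed

lemma exists_product:
  assumes "w2\<^sup>2 \<le> p" "p \<le> w3\<^sup>2"
  shows "\<exists>\<psi>. product \<psi> = p"
proof -
  define c where "c = sqrt ((w3\<^sup>2 - p) / (w3\<^sup>2 - w2\<^sup>2))"
  have c: "0 \<le> c" "c \<le> 1" "c\<^sup>2 = (w3\<^sup>2 - p) / (w3\<^sup>2 - w2\<^sup>2)"
    using assms squares by (auto simp: c_def divide_simps)
  then show ?thesis using squares by (intro exI[of _ "arcsin c"]) (simp add: product_def)
qed

lemma curve_point_eq_or_minus:
  assumes "z \<in> C_plus d K" "fst z * snd z = product \<psi>"
  shows "z = curve_point \<psi> \<or> z = curve_point (- \<psi>)"
  using C_plus_same_product[of "fst (curve_point \<psi>)" "snd (curve_point \<psi>)" "fst z" "snd z"] assms curve_point_in_C_plus[of \<psi>] curve_point_props(1)[of \<psi>]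
  by (auto simp: curve_point_minus prod.swap_def)

lemma range_curve_point: "range curve_point = C_plus d K"
proof
  show "range curve_point \<subseteq> C_plus d K" using curve_point_in_C_plus by auto
  show "C_plus d K \<subseteq> range curve_point"
  proof
    fix z assume z: "z \<in> C_plus d K"
    then have "w2\<^sup>2 \<le> fst z * snd z" "fst z * snd z \<le> w3\<^sup>2"
      using C_plus_product_bounds[of "fst z" "snd z"] by auto
    then obtain \<psi> where "product \<psi> = fst z * snd z" using exists_product by blast
    then show "z \<in> range curve_point" using curve_point_eq_or_minus[OF z, of \<psi>] by auto
  qed
qed

definition flow_point :: "real \<Rightarrow> real \<times> real" where
  "flow_point t = curve_point (amplitude m t)"

lemma flow_point_elliptic_F: "flow_point (elliptic_F m \<psi>) = curve_point \<psi>"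
  by (simp add: flow_point_def m)

lemma range_flow_point: "range flow_point = C_plus d K"
proof -
  have "range flow_point = curve_point ` range (amplitude m)" by (auto simp: flow_point_def)
  also have "range (amplitude m) = UNIV" using amplitude_elliptic_F[OF m] by (metis surjI)
  finally show ?thesis by (simp add: range_curve_point)
qed

lemma flow_point_eq_iff: "flow_point t = flow_point t' \<longleftrightarrow> (\<exists>n::int. t' = t + n * elliptic_F m pi)"
proof -
  have F: "elliptic_F m (\<psi> + n * pi) = elliptic_F m \<psi> + n * elliptic_F m pi" for \<psi> and n :: int
  proof (induction n rule: int_induct[of _ 0])
    case (step1 i)
    then show ?case using elliptic_F_translate_pi[OF m, of "\<psi> + i * pi"]
      by (simp add: algebra_simps)
  next
    case (step2 i)
    then show ?case using elliptic_F_translate_pi[OF m, of "\<psi> + (i - 1) * pi"]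
      by (simp add: algebra_simps)
  qed simp
  have "amplitude m t' = amplitude m t + n * pi \<longleftrightarrow> t' = t + n * elliptic_F m pi" for n :: int
    by (metis F amplitude_elliptic_F[OF m] elliptic_F_amplitude[OF m])
  then show ?thesis by (simp add: flow_point_def curve_point_eq_iff)
qed

text \<open>In the coordinates \<open>p = x * y\<close> and \<open>q = (y - x) * (p + 1)\<close> the flow,
  slowed down by \<open>\<kappa>\<close>, reads \<open>\<kappa> * p' = q\<close> and \<open>\<kappa> * q' = Q'
  (p) / 2\<close>, where \<open>q\<^sup>2 = Q (p)\<close> is the factored cubic. Both follow from the derivative
  of the amplitude; transporting them to \<open>x\<close> and \<open>y\<close> is algebra.\<close>

lemma flow_line_flow_point: "flow_line (1 / \<kappa>) K flow_point"
  unfolding flow_line_def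
proof
  fix t
  define \<psi> where "\<psi> = amplitude m"
  define R where "R t = sqrt (1 - m * (sin (\<psi> t))\<^sup>2)" for t
  define p where "p t = product (\<psi> t)" for t
  define q where "q t = weighted_gap (\<psi> t)" for t
  have R: "R t > 0" "(R t)\<^sup>2 = 1 - m * (sin (\<psi> t))\<^sup>2" for t
    using elliptic_radicand_bounds[OF m, of "\<psi> t"] by (auto simp: R_def)
  have d\<psi>: "(\<psi> has_real_derivative R t) (at t)" for t
    using DERIV_amplitude[OF m, of t] by (simp add: \<psi>_def R_def)
  have dp: "(p has_real_derivative q t / \<kappa>) (at t)" for t
    unfolding p_def[abs_def] product_def
  proof -
    have "q t = - ((w3\<^sup>2 - w2\<^sup>2) * (2 * (R t * cos (\<psi> t) * sin (\<psi> t)))) * \<kappa>"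
      unfolding q_def weighted_gap_def R_def by algebra
    then have "q t / \<kappa> = - ((w3\<^sup>2 - w2\<^sup>2) * (2 * (R t * cos (\<psi> t) * sin (\<psi> t))))"
      using kappa(1) by simp
    then show "((\<lambda>t. w3\<^sup>2 - (w3\<^sup>2 - w2\<^sup>2) * (sin (\<psi> t))\<^sup>2) has_real_derivative q t / \<kappa>) (at t)"
      by (auto intro!: derivative_eq_intros d\<psi>)
  qed
  have dR: "(R has_real_derivative - m * sin (\<psi> t) * cos (\<psi> t)) (at t)" for t
  proof -
    have "((\<lambda>t. 1 - m * (sin (\<psi> t))\<^sup>2) has_real_derivative - (m * (2 * (R t * cos (\<psi> t) * sin (\<psi> t))))) (at t)"
      by (auto intro!: derivative_eq_intros d\<psi>)
    from DERIV_chain2[OF DERIV_real_sqrt this] show ?thesis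
      using elliptic_radicand_bounds(1)[OF m, of "\<psi> t"] R(1)[of t] by (simp add: R_def[abs_def] field_simps)
  qed
  define q' where "q' = -2 * (w3\<^sup>2 - w2\<^sup>2) * \<kappa> * ((cos (\<psi> t))\<^sup>2 * (R t)\<^sup>2
     - (sin (\<psi> t))\<^sup>2 * (R t)\<^sup>2 - m * (sin (\<psi> t))\<^sup>2 * (cos (\<psi> t))\<^sup>2)"
  have "((\<lambda>t. - 2 * (w3\<^sup>2 - w2\<^sup>2) * sin (\<psi> t) * cos (\<psi> t) * \<kappa> * R t) has_real_derivative q') (at t)"
    by (rule derivative_eq_intros d\<psi> dR refl)+
       (simp add: q'_def power2_eq_square algebra_simps)
  then have dq: "(q has_real_derivative q') (at t)"
    by (simp add: q_def[abs_def] weighted_gap_def R_def)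
  have q': "\<kappa> * q' = K * (K * p t - d) - 2 * (p t + 1)\<^sup>2 - 4 * p t * (p t + 1)"
  proof -
    note pd = product_differences[of "\<psi> t", folded p_def R(2)]
    have "\<kappa> * q' = -2 * (((w3\<^sup>2 - w2\<^sup>2) * (cos (\<psi> t))\<^sup>2 - (w3\<^sup>2 - w2\<^sup>2) * (sin (\<psi> t))\<^sup>2) * (\<kappa>\<^sup>2 * (R t)\<^sup>2)
       - (m * \<kappa>\<^sup>2) * (sin (\<psi> t))\<^sup>2 * ((w3\<^sup>2 - w2\<^sup>2) * (cos (\<psi> t))\<^sup>2))"
      unfolding q'_def by algebra
    also have "\<dots> = -2 * (((p t - w2\<^sup>2) - (w3\<^sup>2 - p t)) * (p t - w1\<^sup>2) - (w3\<^sup>2 - p t) * (p t - w2\<^sup>2))"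
      unfolding kappa(3) pd ..
    also have "\<dots> = 2 * (w1 + w2 + w3) * (2 * (w1 + w2 + w3) * p t - - 2 * (w1 * w2 * w3))
       - 2 * (p t + (w1 * w2 + w1 * w3 + w2 * w3))\<^sup>2 - 4 * p t * (p t + (w1 * w2 + w1 * w3 + w2 * w3))"
      by algebra
    finally show ?thesis unfolding vieta .
  qed
  have N: "p t + 1 > 0" for t using product_bounds(3)[of "\<psi> t"] by (simp add: p_def)
  define s where "s t = (K * p t - d) / (p t + 1)" for t
  define \<delta> where "\<delta> t = q t / (p t + 1)" for t
  have sN: "s t * (p t + 1) = K * p t - d" and \<delta>N: "\<delta> t * (p t + 1) = q t"
    using N[of t] by (auto simp: s_def \<delta>_def)
  have q2: "(q t)\<^sup>2 = (K * p t - d)\<^sup>2 - 4 * p t * (p t + 1)\<^sup>2"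
    by (simp add: q_def p_def weighted_gap_squared)
  have s\<delta>: "(s t)\<^sup>2 - (\<delta> t)\<^sup>2 = 4 * p t"
  proof -
    have "((s t)\<^sup>2 - (\<delta> t)\<^sup>2 - 4 * p t) * (p t + 1)\<^sup>2 = 0"
      using sN \<delta>N q2 by algebra
    then show ?thesis using N[of t] by simp
  qed
  \<comment> \<open>Writing the inverse of \<open>\<kappa>\<close> as a variable keeps the remaining identities
    polynomial.\<close>
  define i where "i = 1 / \<kappa>"
  have i: "i * \<kappa> = 1" using kappa(1) by (simp add: i_def)
  define s' where "s' = (K * (q t * i) * (p t + 1) - (K * p t - d) * (q t * i)) / (p t + 1)\<^sup>2"
  define \<delta>' where "\<delta>' = (q' * (p t + 1) - q t * (q t * i)) / (p t + 1)\<^sup>2"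
  have ds: "(s has_real_derivative s') (at t)"
    unfolding s_def[abs_def]
    by (rule derivative_eq_intros dp refl | use N[of t] in force)+
       (use N[of t] in \<open>simp add: s'_def i_def power2_eq_square\<close>)
  have d\<delta>: "(\<delta> has_real_derivative \<delta>') (at t)"
    unfolding \<delta>_def[abs_def]
    by (rule derivative_eq_intros dp dq refl | use N[of t] in force)+
       (use N[of t] in \<open>simp add: \<delta>'_def i_def power2_eq_square\<close>)
  have s'N: "s' * (p t + 1)\<^sup>2 = K * (q t * i) * (p t + 1) - (K * p t - d) * (q t * i)"
    and \<delta>'N: "\<delta>' * (p t + 1)\<^sup>2 = q' * (p t + 1) - q t * (q t * i)"
    using N[of t] by (auto simp: s'_def \<delta>'_def)
  have s': "s' = i * (\<delta> t * (K - s t))"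
  proof -
    have "(s' - i * (\<delta> t * (K - s t))) * (p t + 1)\<^sup>2 = 0"
      using s'N sN \<delta>N by algebra
    then show ?thesis using N[of t] by simp
  qed
  have q'i: "q' = i * (K * (K * p t - d) - 2 * (p t + 1)\<^sup>2 - 4 * p t * (p t + 1))"
    using q' i by algebra
  have \<delta>': "\<delta>' = i * (K * s t - (s t)\<^sup>2 - 2 * p t - 2)"
  proof -
    have "(\<delta>' - i * (K * s t - (s t)\<^sup>2 - 2 * p t - 2)) * (p t + 1)\<^sup>2 = 0"
      using \<delta>'N sN q2 unfolding q'i by algebra
    then show ?thesis using N[of t] by simp
  qed
  have coords: "flow_point t = ((s t - \<delta> t) / 2, (s t + \<delta> t) / 2)" for t
    by (simp add: flow_point_def curve_point_def Let_def s_def \<delta>_def p_def q_def \<psi>_def)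
  have dx: "((\<lambda>t. (s t - \<delta> t) / 2) has_real_derivative (s' - \<delta>') / 2) (at t)"
    and dy: "((\<lambda>t. (s t + \<delta> t) / 2) has_real_derivative (s' + \<delta>') / 2) (at t)"
    by (auto intro!: derivative_eq_intros ds d\<delta>)
  have x: "(s' - \<delta>') / 2 = i * (((s t - \<delta> t) / 2)\<^sup>2 + 2 * ((s t - \<delta> t) / 2) * ((s t + \<delta> t) / 2) + 1
       - K * ((s t - \<delta> t) / 2))"
    and y: "(s' + \<delta>') / 2 = - i * (((s t + \<delta> t) / 2)\<^sup>2 + 2 * ((s t - \<delta> t) / 2) * ((s t + \<delta> t) / 2) + 1
       - K * ((s t + \<delta> t) / 2))"
    unfolding s' \<delta>' using s\<delta> by (simp_all add: field_simps power2_eq_square) algebra+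
  show "((\<lambda>t. fst (flow_point t)) has_real_derivative
        1 / \<kappa> * ((fst (flow_point t))\<^sup>2 + 2 * fst (flow_point t) * snd (flow_point t) + 1 - K * fst (flow_point t))) (at t) \<and>
     ((\<lambda>t. snd (flow_point t)) has_real_derivative
        - (1 / \<kappa>) * ((snd (flow_point t))\<^sup>2 + 2 * fst (flow_point t) * snd (flow_point t) + 1 - K * snd (flow_point t))) (at t)"
    using dx dy unfolding coords fst_conv snd_conv x y i_def by blast
qed

lemma continuous_flow_point: "continuous_on UNIV flow_point"
proof -
  have "isCont (\<lambda>t. (fst (flow_point t), snd (flow_point t))) t" for t
    using flow_line_flow_point unfolding flow_line_def
    by (intro continuous_Pair) (blast intro: DERIV_isCont)+
  then show ?thesis by (simp add: continuous_at_imp_continuous_on)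
qed

lemma C_plus_subset_box: "C_plus d K \<subseteq> {0..K} \<times> {0..K}"
proof clarify
  fix x y assume xy: "(x, y) \<in> C_plus d K"
  then have "x > 0" "y > 0" "G d (x, y) = K" by (auto simp: C_plus_def)
  moreover have "1 / x > 0" "1 / y > 0" "d / (x * y) > 0" using calculation d_pos by auto
  ultimately show "x \<in> {0..K} \<and> y \<in> {0..K}" unfolding G_def atLeastAtMost_iff by force
qed

text \<open>Both sides are flow lines in a fixed square, equal at \<open>0\<close>.\<close>

lemma F_flow_point:
  assumes "F d (flow_point 0) = flow_point c"
  shows "F d (flow_point t) = flow_point (t + c)"
proof -
  have C: "flow_point t \<in> C_plus d K" for t using range_flow_point by auto
  have FF: "F d (flow_point t) = half_F d (half_F d (flow_point t))" for t
    using C[of t] F_eq_half_F_twice[OF d_pos, of "fst (flow_point t)" "snd (flow_point t)"]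
    by (auto simp: C_plus_def)
  have C1: "half_F d (flow_point t) \<in> C_plus d K" for t by (intro half_F_C_plus C d_pos)
  have "flow_line (1 / \<kappa>) K (\<lambda>t. F d (flow_point t))"
    unfolding FF by (intro flow_line_half_F[where d = d] flow_line_flow_point C C1)
  moreover have "F d (flow_point t) \<in> {0..K} \<times> {0..K}" for t
    using half_F_C_plus[OF d_pos C1] C_plus_subset_box by (auto simp: FF)
  moreover have "flow_point t \<in> {0..K} \<times> {0..K}" for t using C C_plus_subset_box by blast
  ultimately show ?thesis
    using flow_line_unique[OF _ flow_line_translate[OF flow_line_flow_point, of c], of "\<lambda>t. F d (flow_point t)" 0 t] assms
    by simp
qed

text \<open>The angle reached from the diagonal point by one application of \<^const>\<open>F\<close>, up to
  sign.\<close>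

definition shift_angle where "shift_angle = arctan (sqrt ((w3\<^sup>2 - w1\<^sup>2) / w1\<^sup>2))"

text \<open>The start is \<open>(w3, w3)\<close>. Its image is identified by the product of its coordinates
  alone, since that determines a point of the curve up to reflection in the diagonal.\<close>

lemma F_flow_point_0: "F d (flow_point 0) = curve_point shift_angle \<or> F d (flow_point 0) = curve_point (- shift_angle)"
proof -
  have w3: "w3 > 0" using w1 w12 w23 by simp
  have "product 0 = w3\<^sup>2" "weighted_gap 0 = 0" by (simp_all add: product_def weighted_gap_def)
  moreover have "(K * w3\<^sup>2 - d) / (w3\<^sup>2 + 1) = 2 * w3"
    unfolding diagonal_root[of w3, simplified]
    by (simp add: divide_simps add_nonneg_eq_0_iff) algebra
  ultimately have flow_point0: "flow_point 0 = (w3, w3)"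
    by (simp only: flow_point_def amplitude_0[OF m] curve_point_def Let_def) simp
  have "(sin shift_angle)\<^sup>2 = (w3\<^sup>2 - w1\<^sup>2) / w3\<^sup>2"
  proof -
    have "(sqrt ((w3\<^sup>2 - w1\<^sup>2) / w1\<^sup>2))\<^sup>2 = (w3\<^sup>2 - w1\<^sup>2) / w1\<^sup>2" using squares by simp
    moreover have "1 + (w3\<^sup>2 - w1\<^sup>2) / w1\<^sup>2 = w3\<^sup>2 / w1\<^sup>2" using w1 by (simp add: field_simps)
    ultimately show ?thesis using squares w1 w3
      by (simp add: shift_angle_def sin_arctan power_divide del: real_sqrt_divide)
  qed
  then have p: "(w3\<^sup>2 - product shift_angle) * w3\<^sup>2 = (w3\<^sup>2 - w2\<^sup>2) * (w3\<^sup>2 - w1\<^sup>2)"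
    using w3 by (simp add: product_def)
  have q: "fst (F d (w3, w3)) * snd (F d (w3, w3)) = (d * w3\<^sup>2 + w3 + d) / w3 ^ 3"
    using w3 d_pos by (simp add: F_def power2_eq_square power3_eq_cube divide_simps add_pos_pos)
  \<comment> \<open>Eliminating \<open>d\<close> and the unit through the symmetric functions identifies the two
    products.\<close>
  have "((d * w3\<^sup>2 + w3 + d) - product shift_angle * w3 ^ 3) * w3 = 0"
    using p vieta by algebra
  then have "d * w3\<^sup>2 + w3 + d = product shift_angle * w3 ^ 3" using w3 by (metis eq_iff_diff_eq_0 less_irrefl mult_eq_0_iff)
  then have "fst (F d (flow_point 0)) * snd (F d (flow_point 0)) = product shift_angle"
    unfolding flow_point0 q using w3 by (simp add: field_simps)
  moreover have "F d (flow_point 0) \<in> C_plus d K"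
    using half_F_C_plus[OF d_pos half_F_C_plus[OF d_pos, of "flow_point 0" K]] rangeI[of flow_point 0]
      F_eq_half_F_twice[OF d_pos w3 w3] by (simp add: flow_point0 range_flow_point)
  ultimately show ?thesis by (intro curve_point_eq_or_minus)
qed

text \<open>The two possible images of the starting point differ by the orientation in which the curve is
  traversed; both give the same rotation angle.\<close>

lemma conjugated_rotation:
  "conjugated_on (C_plus d K) (F d) circle (rotation (2 * pi * (elliptic_F m shift_angle / elliptic_F m pi)))"
proof -
  have T: "elliptic_F m pi > 0" by (intro elliptic_F_pos m) simp
  consider "F d (flow_point 0) = flow_point (elliptic_F m shift_angle)" | "F d (flow_point 0) = flow_point (- elliptic_F m shift_angle)"
    using F_flow_point_0 flow_point_elliptic_F[of "- shift_angle"] flow_point_elliptic_F[of shift_angle] by (auto simp: elliptic_F_minus m)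
  then show ?thesis
  proof cases
    case 1
    show ?thesis
      by (rule conjugated_on_rotation_of_periodic_parametrisation[of _ flow_point])
         (use T continuous_flow_point range_flow_point flow_point_eq_iff F_flow_point[OF 1] in auto)
  next
    case 2
    \<comment> \<open>Traversing the curve backwards turns a translation by \<open>- c\<close> into one by \<open>c\<close>.\<close>
    show ?thesis
    proof (rule conjugated_on_rotation_of_periodic_parametrisation[of _ "\<lambda>t. flow_point (- t)"])
      show "continuous_on UNIV (\<lambda>t. flow_point (- t))"
        by (rule continuous_on_compose2[OF continuous_flow_point]) (auto intro!: continuous_intros)
      show "range (\<lambda>t. flow_point (- t)) = C_plus d K"
        using range_flow_point surj_uminus by (metis image_image)
      show "flow_point (- t) = flow_point (- t') \<longleftrightarrow> (\<exists>n::int. t' = t + n * elliptic_F m pi)" for t t'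
      proof -
        have "- t' = - t + n * elliptic_F m pi \<longleftrightarrow> t' = t + (- n) * elliptic_F m pi" for n :: int
          by (auto simp: algebra_simps)
        then show ?thesis unfolding flow_point_eq_iff
          by (metis add.inverse_inverse)
      qed
      show "F d (flow_point (- t)) = flow_point (- (t + elliptic_F m shift_angle))" for t
        using F_flow_point[OF 2] by simp
    qed (rule T)
  qed
qed

end

section \<open>Diagonal points and the roots of the cubic\<close>

text \<open>The value of \<^const>\<open>G\<close> at \<open>(w, w)\<close>, for negative \<open>w\<close> as
  well.\<close>

definition diag_level :: "real \<Rightarrow> real \<Rightarrow> real" where
  "diag_level d w = 2 * w + 2 / w + d / w\<^sup>2"

lemma diag_level_eq_iff:
  assumes "w \<noteq> 0"
  shows "diag_level d w = K \<longleftrightarrow> K * w\<^sup>2 = 2 * w ^ 3 + 2 * w + d"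
proof -
  have "diag_level d w * w\<^sup>2 = 2 * w ^ 3 + 2 * w + d"
    using assms by (simp add: diag_level_def field_simps power2_eq_square power3_eq_cube)
  then show ?thesis using assms by (metis mult_cancel_right power_not_zero)
qed

text \<open>The cubic \<open>R\<close> whose roots are the diagonal coordinates is negative at \<open>ell
  d\<close>, where \<open>R\<close> equals \<open>(ell d)\<^sup>2 * (K_min d - K)\<close>; this separates the
  two positive roots by a point that does not depend on \<open>K\<close>. Dividing differences of values of
  \<open>R\<close> by differences of roots yields the symmetric functions.\<close>

lemma ex_diagonal_roots:
  assumes d: "d > 0" and K: "K > K_min d"
  shows "\<exists>w1 w2 w3. diagonal_roots d K w1 w2 w3 \<and> w2 < ell d \<and> ell d < w3"
proof -
  define l where "l = ell d"
  have l: "l > 1" and dl: "d = l ^ 3 - l" and Km: "K_min d = 3 * l + 1 / l"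
    using ell_props[OF d] by (auto simp: l_def)
  define R where "R w = 2 * w ^ 3 - K * w\<^sup>2 + 2 * w + d" for w
  have cont: "continuous_on S R" for S unfolding R_def by (intro continuous_intros)
  have "1 / l > 0" using l by simp
  then have Kl: "K > 3 * l" using K Km by linarith
  have R1: "R (- d) < 0"
  proof -
    have "R (- d) = - 2 * d ^ 3 - K * d\<^sup>2 - d" by (simp add: R_def)
    moreover have "d ^ 3 > 0" "K * d\<^sup>2 > 0" using d Kl l by auto
    ultimately show ?thesis using d by linarith
  qed
  have R0: "R 0 > 0" using d by (simp add: R_def)
  have Rl: "R l < 0"
  proof -
    have "R l = l\<^sup>2 * (3 * l + 1 / l - K)"
    proof -
      have "l * (1 / l) = 1" using l by simp
      then show ?thesis unfolding R_def using dl by algebra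
    qed
    then show ?thesis using K Km l by (simp add: mult_pos_neg)
  qed
  have RK: "R K > 0"
  proof -
    have "R K = K ^ 3 + 2 * K + d" by (simp add: R_def power2_eq_square power3_eq_cube)
    then show ?thesis using d Kl l by (simp add: add_pos_pos)
  qed
  obtain w1 where w1: "- d \<le> w1" "w1 \<le> 0" "R w1 = 0"
    using IVT'[of R "- d" 0 0] R1 R0 cont d by force
  obtain w2 where w2: "0 \<le> w2" "w2 \<le> l" "R w2 = 0"
    using IVT2'[of R l 0 0] Rl R0 cont l by force
  obtain w3 where w3: "l \<le> w3" "w3 \<le> K" "R w3 = 0"
    using IVT'[of R l 0 K] Rl RK cont l Kl by force
  have "w1 \<noteq> 0" "w2 \<noteq> 0" "w2 \<noteq> l" "w3 \<noteq> l" using R0 Rl w1 w2 w3 by auto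
  then have lt: "w1 < 0" "0 < w2" "w2 < l" "l < w3" using w1 w2 w3 by auto
  have quot: "2 * (u\<^sup>2 + u * v + v\<^sup>2) - K * (u + v) + 2 = 0" if "R u = 0" "R v = 0" "u \<noteq> v" for u v
  proof -
    have "(u - v) * (2 * (u\<^sup>2 + u * v + v\<^sup>2) - K * (u + v) + 2) = 0"
      using that(1,2) unfolding R_def by algebra
    then show ?thesis using that(3) by simp
  qed
  have q12: "2 * (w1\<^sup>2 + w1 * w2 + w2\<^sup>2) - K * (w1 + w2) + 2 = 0"
    and q13: "2 * (w1\<^sup>2 + w1 * w3 + w3\<^sup>2) - K * (w1 + w3) + 2 = 0"
    using quot w1 w2 w3 lt by auto
  have "(w2 - w3) * (2 * (w1 + w2 + w3) - K) = 0" using q12 q13 by algebra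
  then have v1: "2 * (w1 + w2 + w3) = K" using lt by simp
  have v2: "w1 * w2 + w1 * w3 + w2 * w3 = 1" using q12 v1 by algebra
  have v3: "- 2 * (w1 * w2 * w3) = d" using w1(3) v1 v2 unfolding R_def by algebra
  \<comment> \<open>Both sides are values of \<open>2 * w ^ 3 + 2 * w + d\<close>, below \<open>d\<close> for
    negative and above \<open>d\<close> for positive \<open>w\<close>.\<close>
  have "K * w1\<^sup>2 < K * w2\<^sup>2"
  proof -
    have "K * w1\<^sup>2 = 2 * w1 ^ 3 + 2 * w1 + d" "K * w2\<^sup>2 = 2 * w2 ^ 3 + 2 * w2 + d"
      using w1 w2 by (auto simp: R_def)
    moreover have "w1 ^ 3 < 0" "0 < w2 ^ 3" using lt by simp_all
    ultimately show ?thesis using lt by linarith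
  qed
  then have "(- w1)\<^sup>2 < w2\<^sup>2" using Kl l by simp
  then have "- w1 < w2" using lt by (intro power_less_imp_less_base[of "- w1" 2 w2]) auto
  then have "diagonal_roots d K w1 w2 w3"
    using lt v1 v2 v3 by unfold_locales auto
  then show ?thesis using lt l_def by blast
qed

context diagonal_roots
begin

text \<open>Up to a factor \<open>w ^ 3 / 2\<close> the left-hand side is the derivative of the level \<open>2 *
  w + 2 / w + d / w\<^sup>2\<close> at a root, so the statement says that the level is locally invertible
  there.\<close>

lemma diagonal_root_simple:
  assumes "w \<in> {w1, w2, w3}"
  shows "w ^ 3 - w - d \<noteq> 0"
proof -
  let ?e2 = "w1 * w2 + w1 * w3 + w2 * w3" and ?d = "- 2 * (w1 * w2 * w3)"
  have "w1 ^ 3 - w1 * ?e2 - ?d = w1 * (w1 - w2) * (w1 - w3)" "w2 ^ 3 - w2 * ?e2 - ?d = w2 * (w2 - w1) * (w2 - w3)"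
    "w3 ^ 3 - w3 * ?e2 - ?d = w3 * (w3 - w1) * (w3 - w2)"
    by algebra+
  then have e: "w1 ^ 3 - w1 - d = w1 * (w1 - w2) * (w1 - w3)" "w2 ^ 3 - w2 - d = w2 * (w2 - w1) * (w2 - w3)"
    "w3 ^ 3 - w3 - d = w3 * (w3 - w1) * (w3 - w2)"
    unfolding vieta by simp_all
  have "w ^ 3 - w - d \<in> {w1 * (w1 - w2) * (w1 - w3), w2 * (w2 - w1) * (w2 - w3), w3 * (w3 - w1) * (w3 - w2)}"
    using assms e by auto
  then show ?thesis using w1 w12 w23 by auto
qed

text \<open>The affine substitution \<open>X = X_coord K - K * p\<close> carries \<^const>\<open>cubic\<close>
  to \<open>K ^ 3\<close> times the factored cubic in \<open>p\<close>. It reverses the order, so the largest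
  root comes from the smallest square \<open>w1\<^sup>2\<close>.\<close>

lemma e_eq:
  "e1 d K = X_coord K - K * w1\<^sup>2" "e2 d K = X_coord K - K * w2\<^sup>2" "e3 d K = X_coord K - K * w3\<^sup>2"
proof -
  have cubic: "cubic d K (X_coord K - K * p) = K ^ 3 * (4 * (p - w1\<^sup>2) * (p - w2\<^sup>2) * (w3\<^sup>2 - p))" for p
  proof -
    have s: "X_coord K - K * p - A d K / 12 = d - K * p"
      by (simp add: X_coord_def A_def field_simps)
    show ?thesis unfolding product_cubic_factored[symmetric] cubic_def s unfolding A_def by algebra
  qed
  have set_eq: "{X. cubic d K X = 0} = {X_coord K - K * w3\<^sup>2, X_coord K - K * w2\<^sup>2, X_coord K - K * w1\<^sup>2}"
  proof (rule set_eqI)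
    fix X
    define p where "p = (X_coord K - X) / K"
    have X: "X = X_coord K - K * p" using K_pos by (simp add: p_def)
    show "X \<in> {X. cubic d K X = 0} \<longleftrightarrow> X \<in> {X_coord K - K * w3\<^sup>2, X_coord K - K * w2\<^sup>2, X_coord K - K * w1\<^sup>2}"
      unfolding X using K_pos by (auto simp: cubic)
  qed
  have "roots d K = [X_coord K - K * w3\<^sup>2, X_coord K - K * w2\<^sup>2, X_coord K - K * w1\<^sup>2]"
    unfolding roots_def set_eq
    by (rule sorted_list_of_set_unique[THEN iffD1]) (use squares K_pos in auto)
  then show "e1 d K = X_coord K - K * w1\<^sup>2" "e2 d K = X_coord K - K * w2\<^sup>2" "e3 d K = X_coord K - K * w3\<^sup>2"
    by (simp_all add: e1_def e2_def e3_def)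
qed

lemma eps_eq: "eps d K = 1 - m"
proof -
  have "eps d K = (K * (w2\<^sup>2 - w1\<^sup>2)) / (K * (w3\<^sup>2 - w1\<^sup>2))"
    by (simp add: eps_def e_eq algebra_simps)
  also have "\<dots> = (w2\<^sup>2 - w1\<^sup>2) / (w3\<^sup>2 - w1\<^sup>2)" using K_pos by simp
  also have "\<dots> = 1 - m" using squares by (simp add: m_def divide_simps)
  finally show ?thesis .
qed

lemma endpoint_eq: "(e1 d K - e3 d K) / nu d K = (w3\<^sup>2 - w1\<^sup>2) / w1\<^sup>2"
proof -
  have "(e1 d K - e3 d K) / nu d K = (K * (w3\<^sup>2 - w1\<^sup>2)) / (K * w1\<^sup>2)"
    by (simp add: nu_def e_eq algebra_simps)
  then show ?thesis using K_pos by simp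
qed

lemma theta_eq: "theta d K = elliptic_F m shift_angle / elliptic_F m pi"
proof -
  have e: "0 < 1 - m" "1 - m \<le> 1" using m by auto
  have "0 \<le> sqrt ((w3\<^sup>2 - w1\<^sup>2) / w1\<^sup>2)" using squares by simp
  then show ?thesis
    using integral_integrand[OF e, THEN integral_unique] integral_integrand_infinity[OF e, THEN integral_unique]
    by (simp add: theta_def eps_eq endpoint_eq shift_angle_def elliptic_F_pi m)
qed

lemma theta_bounds: "0 < theta d K" "theta d K < 1 / 2"
proof -
  have "0 < shift_angle" using squares by (simp add: shift_angle_def)
  moreover have "shift_angle < pi / 2" using arctan_ubound by (simp add: shift_angle_def)
  ultimately have "0 < elliptic_F m shift_angle" "elliptic_F m shift_angle < elliptic_F m (pi / 2)"
    using elliptic_F_pos[OF m] strict_monoD[OF elliptic_F_strict_mono[OF m]] by auto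
  then show "0 < theta d K" "theta d K < 1 / 2" by (simp_all add: theta_eq elliptic_F_pi m)
qed

text \<open>Rescaling \<open>u = sqrt a * s\<close> fixes the interval of integration and leaves only
  \<open>a\<close>, not its square root, inside the integral; so it can be continued to complex
  parameters.\<close>

lemma elliptic_F_incomplete_unit_interval:
  defines "a \<equiv> (w3\<^sup>2 - w1\<^sup>2) / w1\<^sup>2"
  shows "((\<lambda>s. sqrt a * (1 / sqrt (1 + (a + (1 - m) * a) * s\<^sup>2 + (1 - m) * a\<^sup>2 * s ^ 4)))
     has_integral elliptic_F m shift_angle) {0..1}"
proof -
  have a: "a \<ge> 0" using squares by (simp add: a_def)
  have e: "0 < 1 - m" "1 - m \<le> 1" using m by auto
  have "((\<lambda>s. elliptic_F m (arctan (sqrt a * s))) has_real_derivative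
     integrand (1 - m) (sqrt a * s) * sqrt a) (at s)" for s
    by (rule DERIV_chain2[of "\<lambda>u. elliptic_F m (arctan u)"])
       (use DERIV_elliptic_F_arctan[OF e] in \<open>auto intro!: derivative_eq_intros\<close>)
  moreover have "integrand (1 - m) (sqrt a * s) * sqrt a
     = sqrt a * (1 / sqrt (1 + (a + (1 - m) * a) * s\<^sup>2 + (1 - m) * a\<^sup>2 * s ^ 4))" for s
  proof -
    have s2: "(sqrt a * s)\<^sup>2 = a * s\<^sup>2" using a by (simp add: power_mult_distrib)
    have "(1 + a * s\<^sup>2) * (1 + (1 - m) * (a * s\<^sup>2)) = 1 + (a + (1 - m) * a) * s\<^sup>2 + (1 - m) * a\<^sup>2 * s ^ 4"
      by algebra
    then show ?thesis by (simp add: integrand_def s2)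
  qed
  ultimately have "((\<lambda>s. sqrt a * (1 / sqrt (1 + (a + (1 - m) * a) * s\<^sup>2 + (1 - m) * a\<^sup>2 * s ^ 4)))
     has_integral elliptic_F m (arctan (sqrt a * 1)) - elliptic_F m (arctan (sqrt a * 0))) {0..1}"
    by (intro fundamental_theorem_of_calculus)
       (auto simp flip: has_real_derivative_iff_has_vector_derivative intro: has_field_derivative_at_within)
  then show ?thesis by (simp add: shift_angle_def a_def)
qed

text \<open>The summand \<open>0 * 0\<close> brings the radicand to the shape \<open>1 + a * g s + b * h
  s\<close> shared with the incomplete integral.\<close>

lemma elliptic_F_complete_integral:
  "((\<lambda>s. 1 / sqrt (1 + (- m) * (sin s)\<^sup>2 + 0 * 0)) has_integral elliptic_F m (pi / 2)) {0..pi / 2}"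
proof -
  have "elliptic_integrand m integrable_on {0..pi / 2}"
    by (intro integrable_continuous_interval continuous_elliptic_integrand m)
  then show ?thesis
    using elliptic_F_pos_eq[of "pi / 2" m]
    by (simp add: elliptic_integrand_def[abs_def] has_integral_integrable_integral)
qed

end

text \<open>The diagonal coordinates as functions of the level; the smallest one is negative, hence the
  sign.\<close>

definition diag1 :: "real \<Rightarrow> real \<Rightarrow> real" where
  "diag1 d K = - sqrt ((X_coord K - e1 d K) / K)"
definition diag2 :: "real \<Rightarrow> real \<Rightarrow> real" where
  "diag2 d K = sqrt ((X_coord K - e2 d K) / K)"
definition diag3 :: "real \<Rightarrow> real \<Rightarrow> real" where
  "diag3 d K = sqrt ((X_coord K - e3 d K) / K)"

lemma (in diagonal_roots) diag_eq: "diag1 d K = w1" "diag2 d K = w2" "diag3 d K = w3"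
  using w1 w12 w23 K_pos by (simp_all add: diag1_def diag2_def diag3_def e_eq)

lemma diagonal_roots_diag:
  assumes "d > 0" "K > K_min d"
  shows "diagonal_roots d K (diag1 d K) (diag2 d K) (diag3 d K)"
    and "diag2 d K < ell d" "ell d < diag3 d K"
proof -
  obtain w1 w2 w3 where w: "diagonal_roots d K w1 w2 w3" "w2 < ell d" "ell d < w3"
    using ex_diagonal_roots[OF assms] by blast
  interpret diagonal_roots d K w1 w2 w3 by fact
  show "diagonal_roots d K (diag1 d K) (diag2 d K) (diag3 d K)" "diag2 d K < ell d" "ell d < diag3 d K"
    using w by (simp_all add: diag_eq)
qed

section \<open>Real analytic functions from holomorphic extensions\<close>

text \<open>The real parts of the Taylor coefficients of a holomorphic extension are the coefficients of a real
  expansion.\<close>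

lemma real_analytic_onI:
  assumes "\<And>x. x \<in> S \<Longrightarrow> \<exists>g. g analytic_on {complex_of_real x} \<and>
     (\<forall>\<^sub>F y in nhds x. g (of_real y) = of_real (f y))"
  shows "real_analytic_on f S"
  unfolding real_analytic_on_def
proof
  fix x assume "x \<in> S"
  then obtain g where g: "g analytic_on {complex_of_real x}"
    "\<forall>\<^sub>F y in nhds x. g (of_real y) = of_real (f y)" using assms by blast
  obtain r where r: "r > 0" "g holomorphic_on ball (of_real x) r"
    using g(1) by (auto simp: analytic_on_def)
  obtain s where s: "s > 0" "\<And>y. dist y x < s \<Longrightarrow> g (of_real y) = of_real (f y)"
    using g(2) by (auto simp: eventually_nhds_metric)
  define a where "a n = Re ((deriv ^^ n) g (of_real x) / fact n)" for n
  have "(\<lambda>n. a n * (y - x) ^ n) sums f y" if "y \<in> ball x (min r s)" for y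
  proof -
    have "of_real y \<in> ball (complex_of_real x) r"
      using that by (simp add: dist_of_real)
    then have "(\<lambda>n. (deriv ^^ n) g (of_real x) / fact n * (of_real y - of_real x) ^ n) sums g (of_real y)"
      by (rule holomorphic_power_series[OF r(2)])
    then have "(\<lambda>n. Re ((deriv ^^ n) g (of_real x) / fact n * (of_real y - of_real x) ^ n)) sums Re (g (of_real y))"
      by (rule sums_Re)
    moreover have "Re ((deriv ^^ n) g (of_real x) / fact n * (of_real y - of_real x) ^ n) = a n * (y - x) ^ n" for n
    proof -
      have "(complex_of_real y - of_real x) ^ n = of_real ((y - x) ^ n)" by simp
      moreover have "Re (c * complex_of_real t) = Re c * t" for c t by simp
      ultimately show ?thesis by (simp only: a_def)
    qed
    moreover have "g (of_real y) = of_real (f y)" using that by (intro s) (simp add: dist_commute)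
    ultimately show ?thesis by simp
  qed
  then show "\<exists>r>0. \<exists>a. \<forall>y\<in>ball x r. (\<lambda>n. a n * (y - x) ^ n) sums f y"
    using r(1) s(1) by (intro exI[of _ "min r s"] conjI exI[of _ a] ballI) simp_all
qed

text \<open>A holomorphic function with nonzero derivative has a local holomorphic inverse. By continuity a real
  branch of the inverse stays in the domain of injectivity, so it is a restriction of the holomorphic
  one.\<close>

lemma analytic_extension_of_real_branch:
  fixes k :: "complex \<Rightarrow> complex" and W :: "real \<Rightarrow> real"
  assumes k: "k holomorphic_on S" "open S" "of_real (W x) \<in> S" "deriv k (of_real (W x)) \<noteq> 0"
    and W: "isCont W x" "\<forall>\<^sub>F y in nhds x. k (of_real (W y)) = of_real y"
  shows "\<exists>g. g analytic_on {of_real x} \<and> (\<forall>\<^sub>F y in nhds x. g (of_real y) = of_real (W y))"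
proof -
  let ?w = "complex_of_real (W x)"
  obtain \<rho> where \<rho>: "\<rho> > 0" "ball ?w \<rho> \<subseteq> S" "inj_on k (ball ?w \<rho>)"
    using has_complex_derivative_locally_injective[OF k(1,3,2,4)] by blast
  have hol: "k holomorphic_on ball ?w \<rho>" using k(1) \<rho>(2) holomorphic_on_subset by blast
  obtain g where g: "g holomorphic_on k ` ball ?w \<rho>" "\<And>z. z \<in> ball ?w \<rho> \<Longrightarrow> g (k z) = z"
    using holomorphic_has_inverse[OF hol open_ball \<rho>(3)] by metis
  have "open (k ` ball ?w \<rho>)" by (rule open_mapping_thm3[OF hol open_ball \<rho>(3)])
  then have an: "g analytic_on k ` ball ?w \<rho>" using g(1) by (simp add: analytic_on_open)
  have "k ?w = of_real x" using W(2) by (rule eventually_nhds_x_imp_x)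
  then have "of_real x \<in> k ` ball ?w \<rho>"
    using \<rho>(1) by (intro image_eqI[of _ k ?w]) simp_all
  then have "g analytic_on {of_real x}" using an analytic_on_subset by blast
  moreover have "\<forall>\<^sub>F y in nhds x. W y \<in> ball (W x) \<rho>"
    using W(1) \<rho>(1) unfolding isCont_def tendsto_at_iff_tendsto_nhds
    by (intro topological_tendstoD) auto
  then have "\<forall>\<^sub>F y in nhds x. g (of_real y) = of_real (W y)"
    using W(2)
  proof eventually_elim
    case (elim y)
    then have "of_real (W y) \<in> ball ?w \<rho>" by (simp add: dist_of_real)
    then show ?case using g(2) elim(2) by metis
  qed
  ultimately show ?thesis by blast
qed

text \<open>Differentiation under the integral sign, with \<open>exp (- Ln w / 2)\<close> as the branch of
  \<open>1 / sqrt w\<close>. The bound \<open>\<delta>\<close> at the centre keeps the radicand in the right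
  half plane, uniformly in \<open>s\<close>, for all nearby \<open>z\<close>.\<close>

lemma analytic_integral_inverse_sqrt:
  fixes a b :: "complex \<Rightarrow> complex" and g h :: "real \<Rightarrow> real"
  assumes a: "a analytic_on {z0}" and b: "b analytic_on {z0}"
    and g: "continuous_on {0..L} g" "\<And>s. s \<in> {0..L} \<Longrightarrow> \<bar>g s\<bar> \<le> 1"
    and h: "continuous_on {0..L} h" "\<And>s. s \<in> {0..L} \<Longrightarrow> \<bar>h s\<bar> \<le> 1"
    and pos: "\<delta> > 0" "\<And>s. s \<in> {0..L} \<Longrightarrow> \<delta> \<le> Re (1 + a z0 * of_real (g s) + b z0 * of_real (h s))"
  shows "(\<lambda>z. integral {0..L} (\<lambda>s. exp (- Ln (1 + a z * of_real (g s) + b z * of_real (h s)) / 2)))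
     analytic_on {z0}"
proof -
  obtain r where r: "r > 0" "a holomorphic_on ball z0 r" "b holomorphic_on ball z0 r"
  proof -
    obtain ra rb where "ra > 0" "a holomorphic_on ball z0 ra" "rb > 0" "b holomorphic_on ball z0 rb"
      using a b by (auto simp: analytic_on_def)
    then show ?thesis by (intro that[of "min ra rb"]) (auto elim!: holomorphic_on_subset)
  qed
  have "isCont a z0" "isCont b z0" using a b by (auto intro: analytic_at_imp_isCont)
  then have ab: "(a \<longlongrightarrow> a z0) (nhds z0)" "(b \<longlongrightarrow> b z0) (nhds z0)"
    unfolding isCont_def tendsto_at_iff_tendsto_nhds .
  have "\<forall>\<^sub>F z in nhds z0. a z \<in> ball (a z0) (\<delta> / 2)"
    by (rule topological_tendstoD[OF ab(1) open_ball]) (use pos(1) in simp)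
  moreover have "\<forall>\<^sub>F z in nhds z0. b z \<in> ball (b z0) (\<delta> / 2)"
    by (rule topological_tendstoD[OF ab(2) open_ball]) (use pos(1) in simp)
  ultimately have "\<forall>\<^sub>F z in nhds z0. a z \<in> ball (a z0) (\<delta> / 2) \<and> b z \<in> ball (b z0) (\<delta> / 2)"
    by (rule eventually_conj)
  then obtain q where q: "q > 0" "\<And>z. dist z z0 < q \<Longrightarrow> a z \<in> ball (a z0) (\<delta> / 2) \<and> b z \<in> ball (b z0) (\<delta> / 2)"
    by (auto simp: eventually_nhds_metric)
  define U where "U = ball z0 (min q r)"
  have U: "open U" "convex U" "z0 \<in> U" using q(1) r(1) by (auto simp: U_def)
  have hol: "a holomorphic_on U" "b holomorphic_on U"
    using r by (auto simp: U_def elim!: holomorphic_on_subset)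
  define H where "H z s = 1 + a z * of_real (g s) + b z * of_real (h s)" for z s
  have H: "H z s \<notin> \<real>\<^sub>\<le>\<^sub>0" if "z \<in> U" "s \<in> {0..L}" for z s
  proof -
    have ab: "norm (a z - a z0) < \<delta> / 2" "norm (b z - b z0) < \<delta> / 2"
      using q(2)[of z] that by (auto simp: U_def dist_norm norm_minus_commute)
    have "norm (H z s - H z0 s) = norm ((a z - a z0) * of_real (g s) + (b z - b z0) * of_real (h s))"
      by (simp add: H_def algebra_simps)
    also have "\<dots> \<le> norm (a z - a z0) * \<bar>g s\<bar> + norm (b z - b z0) * \<bar>h s\<bar>"
      by (rule order_trans[OF norm_triangle_ineq]) (simp add: norm_mult)
    also have "\<dots> \<le> norm (a z - a z0) * 1 + norm (b z - b z0) * 1"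
      using g(2)[OF that(2)] h(2)[OF that(2)] by (intro add_mono mult_left_mono) auto
    also have "\<dots> < \<delta>" using ab by simp
    finally have "\<bar>Re (H z s) - Re (H z0 s)\<bar> < \<delta>"
      using abs_Re_le_cmod[of "H z s - H z0 s"] by simp
    moreover have "\<delta> \<le> Re (H z0 s)" using pos(2)[OF that(2)] by (simp add: H_def)
    ultimately have "Re (H z s) > 0" by linarith
    then show ?thesis by (auto simp: complex_nonpos_Reals_iff)
  qed
  have dab: "(a has_field_derivative deriv a z) (at z)" "(b has_field_derivative deriv b z) (at z)"
    if "z \<in> U" for z
    using hol U(1) that by (auto intro: holomorphic_derivI)
  have cont: "continuous_on U a" "continuous_on U b" "continuous_on U (deriv a)" "continuous_on U (deriv b)"
    using hol U(1) by (auto intro!: holomorphic_on_imp_continuous_on holomorphic_deriv)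
  define H' where "H' z s = deriv a z * of_real (g s) + deriv b z * of_real (h s)" for z s
  have "(\<lambda>z. integral (cbox 0 L) (\<lambda>s. exp (- Ln (H z s) / 2))) holomorphic_on U"
  proof (rule leibniz_rule_holomorphic[where fx = "\<lambda>z s. exp (- Ln (H z s) / 2) * (- (H' z s / H z s) / 2)"])
    fix z s assume zs: "z \<in> U" "s \<in> cbox 0 L"
    have "((\<lambda>z. H z s) has_field_derivative H' z s) (at z)"
      unfolding H_def H'_def using zs by (auto intro!: derivative_eq_intros dab)
    from DERIV_chain2[OF has_field_derivative_Ln[OF H] this] zs
    have "((\<lambda>z. Ln (H z s)) has_field_derivative H' z s / H z s) (at z)"
      by (simp add: divide_inverse mult.commute)
    from DERIV_chain2[OF DERIV_exp DERIV_cdivide[OF DERIV_minus[OF this], of 2]]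
    show "((\<lambda>z. exp (- Ln (H z s) / 2)) has_field_derivative
        exp (- Ln (H z s) / 2) * (- (H' z s / H z s) / 2)) (at z within U)"
      by (rule has_field_derivative_at_within)
  next
    fix z assume z: "z \<in> U"
    have "continuous_on {0..L} (\<lambda>s. H z s)"
      unfolding H_def by (intro continuous_intros g(1) h(1))
    then have "continuous_on {0..L} (\<lambda>s. Ln (H z s))"
      using H[OF z] by (rule continuous_on_Ln')
    then show "(\<lambda>s. exp (- Ln (H z s) / 2)) integrable_on cbox 0 L"
      unfolding box_real by (intro integrable_continuous_interval continuous_on_exp continuous_on_divide continuous_on_minus continuous_on_const) simp_all
  next
    have c2: "continuous_on (U \<times> cbox 0 L) (\<lambda>x. f (fst x))" if "continuous_on U f" for f :: "complex \<Rightarrow> complex"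
      by (rule continuous_on_compose2[OF that]) (auto intro!: continuous_intros)
    have c3: "continuous_on (U \<times> cbox 0 L) (\<lambda>x. f (snd x))" if "continuous_on {0..L} f" for f :: "real \<Rightarrow> real"
      by (rule continuous_on_compose2[OF that]) (auto intro!: continuous_intros)
    have cH: "continuous_on (U \<times> cbox 0 L) (\<lambda>x. H (fst x) (snd x))"
      and cH': "continuous_on (U \<times> cbox 0 L) (\<lambda>x. H' (fst x) (snd x))"
      unfolding H_def H'_def by (intro continuous_intros c2 c3 cont g(1) h(1))+
    have nz: "H (fst x) (snd x) \<noteq> 0" if "x \<in> U \<times> cbox 0 L" for x
      using H[of "fst x" "snd x"] that by auto
    have "continuous_on (U \<times> cbox 0 L) (\<lambda>x. Ln (H (fst x) (snd x)))"
      by (rule continuous_on_Ln'[OF cH]) (use H in auto)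
    then show "continuous_on (U \<times> cbox 0 L) (\<lambda>(z, s). exp (- Ln (H z s) / 2) * (- (H' z s / H z s) / 2))"
      unfolding case_prod_beta using nz
      by (intro continuous_on_mult continuous_on_exp continuous_on_divide continuous_on_minus
            continuous_on_const cH cH') simp_all
  qed (rule U(2))
  then show ?thesis using U(1,3) unfolding H_def box_real
    using analytic_on_open[OF U(1)] analytic_on_subset[of _ U "{z0}"] by auto
qed

lemma exp_minus_Ln_half_of_real:
  assumes "x > 0"
  shows "exp (- Ln (complex_of_real x) / 2) = of_real (1 / sqrt x)"
proof -
  have "exp (- ln x / 2) = 1 / sqrt x"
    using assms by (simp add: exp_minus powr_half_sqrt[symmetric] powr_def field_simps)
  moreover have "- Ln (complex_of_real x) / 2 = of_real (- ln x / 2)"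
    using assms by (simp add: Ln_of_real)
  ultimately show ?thesis by (metis exp_of_real)
qed

lemma integral_exp_minus_Ln_half:
  assumes "((\<lambda>s. 1 / sqrt (f s)) has_integral I) S" "\<And>s. s \<in> S \<Longrightarrow> f s > 0"
    and "\<And>s. s \<in> S \<Longrightarrow> h s = complex_of_real (f s)"
  shows "integral S (\<lambda>s. exp (- Ln (h s) / 2)) = of_real I"
proof (rule integral_unique)
  show "((\<lambda>s. exp (- Ln (h s) / 2)) has_integral of_real I) S"
    by (rule has_integral_eq[OF _ has_integral_of_real[OF assms(1)]])
       (simp only: assms(3) exp_minus_Ln_half_of_real[OF assms(2)])
qed

section \<open>Analytic dependence of the diagonal points on the level\<close>

text \<open>Each coordinate is the only solution of \<open>diag_level d w = K\<close> in a fixed open interval,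
  the three intervals being separated by \<open>0\<close> and \<open>ell d\<close>. It is therefore inverse to
  an injective continuous function on an open set, and invariance of domain makes it continuous.\<close>

lemma isCont_diag:
  assumes d: "d > 0" and K: "K > K_min d"
  shows "isCont (diag1 d) K" "isCont (diag2 d) K" "isCont (diag3 d) K"
proof -
  have *: "isCont W K"
    if I: "open I" "0 \<notin> I" and W: "\<And>K. K > K_min d \<Longrightarrow> W K \<in> I \<and> diag_level d (W K) = K"
      and un: "\<And>K w. K > K_min d \<Longrightarrow> w \<in> I \<Longrightarrow> diag_level d w = K \<Longrightarrow> W K = w" for W I
  proof -
    define S where "S = I \<inter> diag_level d -` {K_min d<..}"
    have cont: "continuous_on I (diag_level d)"
      unfolding diag_level_def[abs_def] using I(2) by (auto intro!: continuous_intros)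
    have "open S" unfolding S_def by (rule continuous_open_preimage[OF cont I(1)]) simp
    have img: "diag_level d ` S = {K_min d<..}"
    proof
      show "{K_min d<..} \<subseteq> diag_level d ` S"
      proof
        fix y assume "y \<in> {K_min d<..}"
        then have "W y \<in> S" "y = diag_level d (W y)" using W[of y] by (auto simp: S_def)
        then show "y \<in> diag_level d ` S" by (rule rev_image_eqI)
      qed
    qed (auto simp: S_def)
    have "continuous_on (diag_level d ` S) W"
      by (rule continuous_on_inverse_open[OF \<open>open S\<close> continuous_on_subset[OF cont]])
         (auto simp: S_def un)
    then show ?thesis using K unfolding img by (simp add: continuous_on_eq_continuous_at)
  qed
  have props: "diag1 d K < 0" "0 < diag2 d K" "diag2 d K < ell d" "ell d < diag3 d K"
     "diag_level d (diag1 d K) = K" "diag_level d (diag2 d K) = K" "diag_level d (diag3 d K) = K"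
     "diag_level d w = K \<Longrightarrow> w \<noteq> 0 \<Longrightarrow> w \<in> {diag1 d K, diag2 d K, diag3 d K}"
    if "K > K_min d" for K w
  proof -
    interpret diagonal_roots d K "diag1 d K" "diag2 d K" "diag3 d K"
      by (rule diagonal_roots_diag[OF d that])
    show "diag1 d K < 0" "0 < diag2 d K" "diag2 d K < ell d" "ell d < diag3 d K"
      using diagonal_roots_diag[OF d that] w1 w12 by auto
    then show "diag_level d (diag1 d K) = K" "diag_level d (diag2 d K) = K" "diag_level d (diag3 d K) = K"
      using ell_props(1)[OF d] by (auto simp: diag_level_eq_iff diagonal_root_iff)
    show "w \<in> {diag1 d K, diag2 d K, diag3 d K}" if "diag_level d w = K" "w \<noteq> 0"
      using that by (simp add: diag_level_eq_iff diagonal_root_iff)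
  qed
  have l: "ell d > 0" using ell_props(1)[OF d] by simp
  show "isCont (diag1 d) K"
  proof (rule *[of "{..<0}"])
    fix K assume K: "K > K_min d"
    note p = props(1-7)[OF K]
    show "diag1 d K \<in> {..<0} \<and> diag_level d (diag1 d K) = K" using p by simp
    show "diag1 d K = w" if "w \<in> {..<0}" "diag_level d w = K" for w
      using props(8)[OF K that(2)] p(1-4) l that(1) by auto
  qed (use l in simp_all)
  show "isCont (diag2 d) K"
  proof (rule *[of "{0<..<ell d}"])
    fix K assume K: "K > K_min d"
    note p = props(1-7)[OF K]
    show "diag2 d K \<in> {0<..<ell d} \<and> diag_level d (diag2 d K) = K" using p by simp
    show "diag2 d K = w" if "w \<in> {0<..<ell d}" "diag_level d w = K" for w
      using props(8)[OF K that(2)] p(1-4) l that(1) by auto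
  qed (use l in simp_all)
  show "isCont (diag3 d) K"
  proof (rule *[of "{ell d<..}"])
    fix K assume K: "K > K_min d"
    note p = props(1-7)[OF K]
    show "diag3 d K \<in> {ell d<..} \<and> diag_level d (diag3 d K) = K" using p by simp
    show "diag3 d K = w" if "w \<in> {ell d<..}" "diag_level d w = K" for w
      using props(8)[OF K that(2)] p(1-4) l that(1) by auto
  qed (use l in simp_all)
qed

text \<open>The level has derivative \<open>2 * (w ^ 3 - w - d) / w ^ 3\<close>, which does not vanish at a
  diagonal point because the three points are distinct.\<close>

lemma analytic_extension_diag:
  assumes d: "d > 0" and K: "K > K_min d" and W: "W \<in> {diag1 d, diag2 d, diag3 d}"
  shows "\<exists>g. g analytic_on {complex_of_real K} \<and> (\<forall>\<^sub>F y in nhds K. g (of_real y) = of_real (W y))"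
proof (rule analytic_extension_of_real_branch)
  define k :: "complex \<Rightarrow> complex" where "k z = 2 * z + 2 / z + of_real d / z\<^sup>2" for z
  have root: "W K' \<noteq> 0 \<and> diag_level d (W K') = K' \<and> W K' ^ 3 - W K' - d \<noteq> 0" if "K' > K_min d" for K'
  proof -
    interpret diagonal_roots d K' "diag1 d K'" "diag2 d K'" "diag3 d K'"
      by (rule diagonal_roots_diag[OF d that])
    have "W K' \<in> {diag1 d K', diag2 d K', diag3 d K'}" using W by auto
    moreover from this have "W K' \<noteq> 0" using w1 w12 w23 by auto
    ultimately show ?thesis using diagonal_root_simple diagonal_root_iff diag_level_eq_iff by blast
  qed
  show "k holomorphic_on - {0}" unfolding k_def by (intro holomorphic_intros) auto
  show "open (- {0} :: complex set)" by (rule open_Compl) simp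
  show "complex_of_real (W K) \<in> - {0}" using root[OF K] by simp
  show "isCont W K" using isCont_diag[OF d K] W by auto
  show "\<forall>\<^sub>F y in nhds K. k (of_real (W y)) = of_real y"
  proof -
    have "\<forall>\<^sub>F y in nhds K. y \<in> {K_min d<..}" using K by (intro eventually_nhds_in_open) auto
    then show ?thesis
    proof eventually_elim
      case (elim y)
      have "k (of_real (W y)) = of_real (diag_level d (W y))" by (simp add: k_def diag_level_def)
      then show ?case using root elim by simp
    qed
  qed
  show "deriv k (of_real (W K)) \<noteq> 0"
  proof -
    define w where "w = complex_of_real (W K)"
    have w: "w \<noteq> 0" using root[OF K] by (simp add: w_def)
    have "(k has_field_derivative 2 - 2 / w\<^sup>2 - 2 * of_real d / w ^ 3) (at w)"
      unfolding k_def[abs_def]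
      by (rule derivative_eq_intros refl | use w in force)+
         (use w in \<open>simp add: field_simps power2_eq_square power3_eq_cube\<close>)
    then have D: "deriv k w = 2 - 2 / w\<^sup>2 - 2 * of_real d / w ^ 3" by (rule DERIV_imp_deriv)
    \<comment> \<open>Clearing denominators reduces the claim to simplicity of the root.\<close>
    have "deriv k w * w ^ 3 = 2 * (w ^ 3 - w - of_real d)"
      unfolding D using w by (simp add: field_simps power2_eq_square power3_eq_cube)
    also have "\<dots> = of_real (2 * (W K ^ 3 - W K - d))" by (simp add: w_def)
    also have "\<dots> \<noteq> 0" using root[OF K] by (metis of_real_eq_0_iff mult_eq_0_iff zero_neq_numeral)
    finally show ?thesis by (auto simp: w_def)
  qed
qed

section \<open>The rotation number\<close>

text \<open>Only \<open>a = (w3\<^sup>2 - w1\<^sup>2) / w1\<^sup>2\<close> and \<open>m\<close> enter: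
  \<open>theta = sqrt a * J1 / (2 * J2)\<close>, where \<open>J1\<close> and \<open>J2\<close> are the
  incomplete integral, rescaled to \<open>{0..1}\<close>, and the complete one. The same expression in the
  continued \<open>w\<^sub>i\<close> is analytic at each real level and agrees with
  \<^const>\<open>theta\<close> on the real axis.\<close>

lemma real_analytic_theta:
  assumes d: "d > 0"
  shows "real_analytic_on (theta d) {K_min d<..}"
proof (rule real_analytic_onI)
  fix K assume "K \<in> {K_min d<..}"
  then have K: "K > K_min d" by simp
  let ?z = "complex_of_real K"
  obtain g1 where g1: "g1 analytic_on {?z}" "\<forall>\<^sub>F y in nhds K. g1 (of_real y) = of_real (diag1 d y)"
    using analytic_extension_diag[OF d K, of "diag1 d"] by blast
  obtain g2 where g2: "g2 analytic_on {?z}" "\<forall>\<^sub>F y in nhds K. g2 (of_real y) = of_real (diag2 d y)"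
    using analytic_extension_diag[OF d K, of "diag2 d"] by blast
  obtain g3 where g3: "g3 analytic_on {?z}" "\<forall>\<^sub>F y in nhds K. g3 (of_real y) = of_real (diag3 d y)"
    using analytic_extension_diag[OF d K, of "diag3 d"] by blast
  note an = g1(1) g2(1) g3(1) and ev = g1(2) g2(2) g3(2)
  define a m where "a z = ((g3 z)\<^sup>2 - (g1 z)\<^sup>2) / (g1 z)\<^sup>2" "m z = ((g3 z)\<^sup>2 - (g2 z)\<^sup>2) / ((g3 z)\<^sup>2 - (g1 z)\<^sup>2)" for z
  define ar mr where "ar y = ((diag3 d y)\<^sup>2 - (diag1 d y)\<^sup>2) / (diag1 d y)\<^sup>2"
    "mr y = ((diag3 d y)\<^sup>2 - (diag2 d y)\<^sup>2) / ((diag3 d y)\<^sup>2 - (diag1 d y)\<^sup>2)" for y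
  define J1 where "J1 z = integral {0..1} (\<lambda>s. exp (- Ln (1 + (a z + (1 - m z) * a z) * of_real (s\<^sup>2)
     + ((1 - m z) * (a z)\<^sup>2) * of_real (s ^ 4)) / 2))" for z
  define J2 where "J2 z = integral {0..pi/2} (\<lambda>s. exp (- Ln (1 + (- m z) * of_real ((sin s)\<^sup>2) + 0 * of_real 0) / 2))" for z
  define \<Theta> where "\<Theta> z = csqrt (a z) * J1 z / (2 * J2 z)" for z
  have val: "ar y > 0 \<and> 0 \<le> mr y \<and> mr y < 1 \<and> a (of_real y) = of_real (ar y) \<and> m (of_real y) = of_real (mr y) \<and>
      (diag1 d y)\<^sup>2 > 0 \<and> (diag3 d y)\<^sup>2 - (diag1 d y)\<^sup>2 > 0 \<and>
      J2 (of_real y) \<noteq> 0 \<and> \<Theta> (of_real y) = of_real (theta d y)"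
    if y: "y > K_min d" "g1 (of_real y) = of_real (diag1 d y)" "g2 (of_real y) = of_real (diag2 d y)"
      "g3 (of_real y) = of_real (diag3 d y)" for y
  proof -
    interpret dr: diagonal_roots d y "diag1 d y" "diag2 d y" "diag3 d y"
      by (rule diagonal_roots_diag[OF d y(1)])
    have mr: "mr y = dr.m" by (simp add: ar_mr_def dr.m_def)
    have ar: "ar y > 0" using dr.squares by (simp add: ar_mr_def)
    have aa: "a (of_real y) = of_real (ar y)" and mm: "m (of_real y) = of_real (mr y)"
      by (simp_all add: a_m_def ar_mr_def y)
    define I where "I = elliptic_F dr.m dr.shift_angle / sqrt (ar y)"
    have "((\<lambda>s. sqrt (ar y) * (1 / sqrt (1 + (ar y + (1 - mr y) * ar y) * s\<^sup>2 + (1 - mr y) * (ar y)\<^sup>2 * s ^ 4)))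
      has_integral elliptic_F dr.m dr.shift_angle) {0..1}"
      using dr.elliptic_F_incomplete_unit_interval unfolding mr ar_mr_def(1) .
    from has_integral_mult_right[OF this, of "1 / sqrt (ar y)"]
    have I1: "((\<lambda>s. 1 / sqrt (1 + (ar y + (1 - mr y) * ar y) * s\<^sup>2 + (1 - mr y) * (ar y)\<^sup>2 * s ^ 4)) has_integral I) {0..1}"
      using ar by (simp add: I_def)
    have J1: "J1 (of_real y) = of_real I"
      unfolding J1_def
    proof (rule integral_exp_minus_Ln_half[OF I1])
      show "1 + (ar y + (1 - mr y) * ar y) * s\<^sup>2 + (1 - mr y) * (ar y)\<^sup>2 * s ^ 4 > 0" for s
      proof -
        have "(ar y + (1 - mr y) * ar y) * s\<^sup>2 \<ge> 0" "(1 - mr y) * (ar y)\<^sup>2 * s ^ 4 \<ge> 0"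
          using ar dr.m by (simp_all add: mr)
        then show ?thesis by linarith
      qed
    qed (simp add: aa mm)
    have J2: "J2 (of_real y) = of_real (elliptic_F dr.m (pi / 2))"
      unfolding J2_def
      by (rule integral_exp_minus_Ln_half[OF dr.elliptic_F_complete_integral])
         (use elliptic_radicand_bounds[OF dr.m] in \<open>auto simp: mm mr\<close>)
    have pos: "elliptic_F dr.m (pi / 2) > 0" by (rule elliptic_F_pos[OF dr.m]) simp
    have "csqrt (a (of_real y)) = of_real (sqrt (ar y))"
      using ar by (simp add: aa)
    then have "\<Theta> (of_real y) = of_real (sqrt (ar y) * I / (2 * elliptic_F dr.m (pi / 2)))"
      by (simp add: \<Theta>_def J1 J2)
    also have "sqrt (ar y) * I / (2 * elliptic_F dr.m (pi / 2)) = theta d y"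
      using ar by (simp add: I_def dr.theta_eq elliptic_F_pi dr.m)
    finally show ?thesis using ar aa mm dr.m pos dr.squares by (simp add: J2 mr)
  qed
  have ev': "\<forall>\<^sub>F y in nhds K. \<Theta> (of_real y) = of_real (theta d y)"
  proof -
    have "\<forall>\<^sub>F y in nhds K. y \<in> {K_min d<..}" using K by (intro eventually_nhds_in_open) auto
    then show ?thesis using ev by eventually_elim (use val in auto)
  qed
  note gK = ev[THEN eventually_nhds_x_imp_x]
  note valK = val[OF K gK]
  have nz: "(g1 ?z)\<^sup>2 \<noteq> 0" "(g3 ?z)\<^sup>2 - (g1 ?z)\<^sup>2 \<noteq> 0"
  proof -
    have "(g1 ?z)\<^sup>2 = of_real ((diag1 d K)\<^sup>2)" "(g3 ?z)\<^sup>2 - (g1 ?z)\<^sup>2 = of_real ((diag3 d K)\<^sup>2 - (diag1 d K)\<^sup>2)"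
      by (simp_all add: gK)
    then show "(g1 ?z)\<^sup>2 \<noteq> 0" "(g3 ?z)\<^sup>2 - (g1 ?z)\<^sup>2 \<noteq> 0" using valK by (metis of_real_eq_0_iff less_irrefl)+
  qed
  have ana: "a analytic_on {?z}" and anm: "m analytic_on {?z}"
    unfolding a_m_def
    by (intro analytic_on_divide analytic_on_diff analytic_on_power an; use nz in simp)+
  have "J1 analytic_on {?z}"
    unfolding J1_def
  proof (rule analytic_integral_inverse_sqrt[where \<delta> = 1])
    fix s :: real assume "s \<in> {0..1}"
    then show "\<bar>s\<^sup>2\<bar> \<le> 1" "\<bar>s ^ 4\<bar> \<le> 1" by (auto intro: power_le_one)
    have "(ar K + (1 - mr K) * ar K) * s\<^sup>2 \<ge> 0" "(1 - mr K) * (ar K)\<^sup>2 * s ^ 4 \<ge> 0"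
      using valK by auto
    moreover have "1 + (a ?z + (1 - m ?z) * a ?z) * of_real (s\<^sup>2) + ((1 - m ?z) * (a ?z)\<^sup>2) * of_real (s ^ 4)
      = of_real (1 + (ar K + (1 - mr K) * ar K) * s\<^sup>2 + (1 - mr K) * (ar K)\<^sup>2 * s ^ 4)"
      using valK by simp
    then have "Re (1 + (a ?z + (1 - m ?z) * a ?z) * of_real (s\<^sup>2) + ((1 - m ?z) * (a ?z)\<^sup>2) * of_real (s ^ 4))
      = 1 + (ar K + (1 - mr K) * ar K) * s\<^sup>2 + (1 - mr K) * (ar K)\<^sup>2 * s ^ 4"
      by (metis Re_complex_of_real)
    ultimately show "1 \<le> Re (1 + (a ?z + (1 - m ?z) * a ?z) * of_real (s\<^sup>2) + ((1 - m ?z) * (a ?z)\<^sup>2) * of_real (s ^ 4))"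
      by linarith
  next
    show "(\<lambda>z. a z + (1 - m z) * a z) analytic_on {?z}" "(\<lambda>z. (1 - m z) * (a z)\<^sup>2) analytic_on {?z}"
      by (intro analytic_on_add analytic_on_mult analytic_on_diff analytic_on_power analytic_on_const ana anm)+
  qed (simp_all add: continuous_on_power)
  moreover have "J2 analytic_on {?z}"
    unfolding J2_def
  proof (rule analytic_integral_inverse_sqrt[where \<delta> = "1 - mr K"])
    fix s :: real
    have "mr K * (sin s)\<^sup>2 \<le> mr K * 1"
      using valK by (intro mult_left_mono) (auto simp: abs_square_le_1)
    moreover have "1 + (- m ?z) * of_real ((sin s)\<^sup>2) + 0 * of_real 0 = of_real (1 - mr K * (sin s)\<^sup>2)"
      using valK by simp
    then have "Re (1 + (- m ?z) * of_real ((sin s)\<^sup>2) + 0 * of_real 0) = 1 - mr K * (sin s)\<^sup>2"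
      by (metis Re_complex_of_real)
    ultimately show "1 - mr K \<le> Re (1 + (- m ?z) * of_real ((sin s)\<^sup>2) + 0 * of_real 0)"
      by linarith
    show "\<bar>(sin s)\<^sup>2\<bar> \<le> 1" by (simp add: abs_square_le_1)
  next
    show "(\<lambda>z. - m z) analytic_on {?z}" by (intro analytic_on_neg anm)
    show "continuous_on {0..pi / 2} (\<lambda>s. (sin s)\<^sup>2)"
      by (intro continuous_on_power continuous_on_sin continuous_on_id)
  qed (use valK in simp_all)
  moreover have "(\<lambda>z. csqrt (a z)) analytic_on {?z}"
    by (rule analytic_on_csqrt'[OF ana]) (use valK in simp)
  ultimately have "\<Theta> analytic_on {?z}"
    unfolding \<Theta>_def
    by (intro analytic_on_divide analytic_on_mult analytic_on_const) (use valK in simp_all)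
  with ev' show "\<exists>g. g analytic_on {?z} \<and> (\<forall>\<^sub>F y in nhds K. g (of_real y) = of_real (theta d y))"
    by blast
qed

theorem theorem7:
  fixes d :: real
  assumes "d > 0"
  shows "(\<forall>K \<in> {K_min d<..}.
            2 * pi * theta d K \<in> {0<..<pi} \<and>
            conjugated_on (C_plus d K) (F d) circle (rotation (2 * pi * theta d K)))
       \<and> real_analytic_on (theta d) {K_min d<..}"
proof (intro conjI ballI real_analytic_theta assms)
  fix K assume "K \<in> {K_min d<..}"
  then interpret diagonal_roots d K "diag1 d K" "diag2 d K" "diag3 d K"
    using diagonal_roots_diag(1)[OF assms] by simp
  show "2 * pi * theta d K \<in> {0<..<pi}" using theta_bounds by simp
  show "conjugated_on (C_plus d K) (F d) circle (rotation (2 * pi * theta d K))"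
    unfolding theta_eq by (rule conjugated_rotation)
qed

end
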